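(* Let $H$ be a group acting on a hierarchically hyperbolic space $(X,\mathfrak S)$ by HHS automorphisms, and fix a basepoint $x_0\in X$. Let $\overline{\mathfrak S}{}^H$ be the set of domains $U\in\mathfrak S$ for which $\pi_U(H\cdot x_0)$ is unbounded. Then there is a finite $H$-invariant set $\mathcal E(H)=\{W_1,\dots,W_n\}\subseteq\overline{\mathfrak S}{}^H$ of pairwise orthogonal domains such that every $U\in\overline{\mathfrak S}{}^H$ is nested in some $W_i$. The set $\mathcal E(H)$ is nonempty if and only if $\overline{\mathfrak S}{}^H$ is nonempty. If the image of $H$ in $\operatorname{Sym}(X)$ induced by the action is finitely generated and $H\cdot x_0$ is unbounded, then $\overline{\mathfrak S}{}^H$ is nonempty, and hence $\mathcal E(H)$ is nonempty.
   Context: **Hierarchically hyperbolic spaces (HHSs).** Let $X$ be a quasigeodesic metric space. An HHS structure $(X,\mathfrak S)$ consists of a set $\mathfrak S$ of *domains*, a constant $E\ge 1$, and for each $U\in\mathfrak S$ a geodesic $E$-hyperbolic space $\mathcal C U$, with the following data and axioms. (Distance between sets means infimal distance. One writes $d_U$ for distance in $\mathcal C U$ and suppresses $\pi_U$: $d_U(x,y)=d_{\mathcal C U}(\pi_U(x),\pi_U(y))$ for $x,y\in X$, $d_U(x,A)=d_{\mathcal C U}(\pi_U(x),A)$ for $A\subseteq\mathcal C U$.) 1. *Projections.* Maps $\pi_U:X\to\mathcal C U$ with $d_U(x,y)\le E\,d_X(x,y)+E$, and every point of $\mathcal C U$ is within $E$ of $\pi_U(X)$. 2. *Nesting.* A partial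 order $\sqsubseteq$ on $\mathfrak S$ with a unique maximal element (if $\mathfrak S\neq\varnothing$). $V\sqsubset W$ means $V\sqsubseteq W$, $V\ne W$ ("properly nested"). $\mathfrak S_W=\{V:V\sqsubseteq W\}$. If $V\sqsubset W$ there are a specified nonempty $\rho^V_W\subseteq\mathcal C W$ of diameter $\le E$ and a map $\rho^W_V:\mathcal C W\to 2^{\mathcal C V}$. 3. *Orthogonality.* A symmetric antireflexive relation $\bot$. If $V\sqsubseteq W$ and $W\bot U$ then $V\bot U$. If $V\bot W$ then $V,W$ are not $\sqsubseteq$-comparable. For each $T\in\mathfrak S$ and $U\in\mathfrak S_T$ with $\{V\in\mathfrak S_T:V\bot U\}\ne\varnothing$ there is $W\in\mathfrak S_T\smallsetminus\{T\}$ such that $V\sqsubseteq W$ whenever $V\in\mathfrak S_T$, $V\bot U$. 4. *Transversality and consistency.* If $V,W$ are distinct, not orthogonal and not $\sqsubseteq$-comparable they are *transverse*, $V\pitchfork W$; then there are nonempty sets $\rho^V_W\subseteq\mathcal C W$, $\rho^W_V\subseteq\mathcal C V$ of diameter $\le E$ with $\min\{d_W(x,\rho^V_W),d_V(x,\rho^W_V)\}\le E$ for all $x\in X$. If $V\sqsubset W$ then $\min\{d_W(x,\rho^V_W),\operatorname{diam}(\{\pi_V(x)\}\cup\rho^W_V(\pi_W(x)))\}\le E$ for all $x\in X$. If $U\sqsubseteq V$ then $d_W(\rho^U_W,\rho^V_W)\le E$ whenever $V\sqsubset W$, or $V\pitchfork W$ and $W\not\perp U$. 5. *Finite complexity.*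 The cardinality of $\sqsubseteq$-chains is bounded; the maximum is the *complexity*. 6. *Large links.* For $W\in\mathfrak S$, $x,x'\in X$ let $N=E\,d_W(x,x')+E$. There are $T_1,\dots,T_{\lfloor N\rfloor}\in\mathfrak S_W\smallsetminus\{W\}$ such that each $T\in\mathfrak S_W\smallsetminus\{W\}$ is nested in some $T_i$ or has $d_T(x,x')<E$; and $d_W(x,\rho^{T_i}_W)\le N$ for all $i$. 7. *Bounded geodesic image.* If $V\sqsubset W$ and $\gamma$ is a geodesic of $\mathcal C W$, then $\operatorname{diam}\rho^W_V(\gamma)\le E$ or $\gamma$ meets the $E$-neighbourhood of $\rho^V_W$. Moreover if $y,z\in X$ have $d_V(y,z)>E$ then $\rho^V_W$ is $E$-close to every geodesic $[\pi_W(y),\pi_W(z)]$. 8. *Partial realisation.* If $\{W_i\}$ are pairwise orthogonal and $p_i\in\mathcal C W_i$, there is $x\in X$ with $d_{W_i}(x,p_i)\le E$ for all $i$ and $d_V(x,\rho^{W_i}_V)\le E$ whenever $W_i\sqsubset V$ or $W_i\pitchfork V$. 9. *Uniqueness.* For each $\kappa$ there is $\theta_u(\kappa)$ such that if $d_X(x,y)>\theta_u(\kappa)$ then $d_U(x,y)>\kappa$ for some $U\in\mathfrak S$. **Actions by HHS automorphisms.** A group $H$ acts on an HHS $(X,\mathfrak S)$ by HHS automorphisms if: $H$ acts on $X$ by isometries; $H$ acts on $\mathfrak S$ (not necessarily cofinitely), preserving $\sqsubseteq,\bot,\pitchfork$; for each $g\in H$ and $U\in\mathfrak S$ there is an isometry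 $g:\mathcal C U\to\mathcal C gU$, with the isometry of a product $gh$ equal to the composition of those of $g$ and $h$; and $g\pi_U(x)=\pi_{gU}(gx)$, $g\rho^V_U=\rho^{gV}_{gU}$ for all $g\in H$, $x\in X$ and all $U,V\in\mathfrak S$ with $U\pitchfork V$ or $V\sqsubset U$. $\operatorname{Sym}(X)$ is the group of all bijections of $X$. *)

theory Defs
  imports
    "HOL-Analysis.Abstract_Metric_Spaces"
    "HOL-Library.Extended_Nonnegative_Real"
    "HOL-Algebra.Group_Action"
    "HOL-Algebra.Generated_Groups"
begin

section \<open>Metric preliminaries\<close>

text \<open>
  Metric spaces are carrier based, as in \<^locale>\<open>Metric_space\<close>. Distances between sets and diameters
  take values in \<^typ>\<open>ennreal\<close>, so an unbounded set has diameter \<open>\<infinity>\<close>.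
\<close>

definition set_dist :: "('a \<Rightarrow> 'a \<Rightarrow> real) \<Rightarrow> 'a set \<Rightarrow> 'a set \<Rightarrow> ennreal" where
  "set_dist d A B = (INF a\<in>A. INF b\<in>B. ennreal (d a b))"

definition set_diam :: "('a \<Rightarrow> 'a \<Rightarrow> real) \<Rightarrow> 'a set \<Rightarrow> ennreal" where
  "set_diam d A = (SUP a\<in>A. SUP b\<in>A. ennreal (d a b))"

definition geodesic_segment :: "'a set \<Rightarrow> ('a \<Rightarrow> 'a \<Rightarrow> real) \<Rightarrow> 'a \<Rightarrow> 'a \<Rightarrow> 'a set \<Rightarrow> bool" where
  "geodesic_segment M d p q \<gamma> \<longleftrightarrow>
     (\<exists>L\<ge>0. \<exists>c::real \<Rightarrow> 'a. c ` {0..L} = \<gamma> \<and> \<gamma> \<subseteq> M \<and> c 0 = p \<and> c L = q \<and>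
        (\<forall>s\<in>{0..L}. \<forall>t\<in>{0..L}. d (c s) (c t) = \<bar>s - t\<bar>))"

definition geodesic_metric_space :: "'a set \<Rightarrow> ('a \<Rightarrow> 'a \<Rightarrow> real) \<Rightarrow> bool" where
  "geodesic_metric_space M d \<longleftrightarrow>
     Metric_space M d \<and> (\<forall>p\<in>M. \<forall>q\<in>M. \<exists>\<gamma>. geodesic_segment M d p q \<gamma>)"

text \<open>Hyperbolicity is in the sense of slim geodesic triangles.\<close>

definition hyperbolic_metric_space :: "real \<Rightarrow> 'a set \<Rightarrow> ('a \<Rightarrow> 'a \<Rightarrow> real) \<Rightarrow> bool" where
  "hyperbolic_metric_space \<delta> M d \<longleftrightarrow>
     (\<forall>x y z \<alpha> \<beta> \<gamma>.
        geodesic_segment M d x y \<alpha> \<and> geodesic_segment M d y z \<beta> \<and> geodesic_segment M d x z \<gamma> \<longrightarrow>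
        (\<forall>p\<in>\<alpha>. set_dist d {p} (\<beta> \<union> \<gamma>) \<le> ennreal \<delta>))"

definition quasigeodesic_metric_space :: "'a set \<Rightarrow> ('a \<Rightarrow> 'a \<Rightarrow> real) \<Rightarrow> bool" where
  "quasigeodesic_metric_space M d \<longleftrightarrow>
     Metric_space M d \<and>
     (\<exists>D\<ge>1. \<forall>x\<in>M. \<forall>y\<in>M. \<exists>L\<ge>0. \<exists>c::real \<Rightarrow> 'a.
        c ` {0..L} \<subseteq> M \<and> c 0 = x \<and> c L = y \<and>
        (\<forall>s\<in>{0..L}. \<forall>t\<in>{0..L}.
           \<bar>s - t\<bar> / D - D \<le> d (c s) (c t) \<and> d (c s) (c t) \<le> D * \<bar>s - t\<bar> + D))"


section \<open>Hierarchically hyperbolic spaces\<close>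

text \<open>
  All hyperbolic spaces \<open>C U\<close>, with metrics \<open>dC U\<close>, live in one type \<open>'c\<close>; no relation between the
  different \<open>C U\<close> is assumed, so this is no restriction. The set \<open>\<rho>\<^sup>V\<^sub>W \<subseteq> C W\<close> is \<open>rho V W\<close>, and the
  map \<open>\<rho>\<^sup>W\<^sub>V\<close> from \<open>C W\<close> to subsets of \<open>C V\<close>, for \<open>V\<close> properly nested in \<open>W\<close>, is \<open>rhomap W V\<close>.
\<close>

locale hhs_data =
  fixes X :: "'x set" and dX :: "'x \<Rightarrow> 'x \<Rightarrow> real"
    and S :: "'u set" and E :: real
    and C :: "'u \<Rightarrow> 'c set" and dC :: "'u \<Rightarrow> 'c \<Rightarrow> 'c \<Rightarrow> real"
    and proj :: "'u \<Rightarrow> 'x \<Rightarrow> 'c"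
    and nest :: "'u \<Rightarrow> 'u \<Rightarrow> bool" (infix "\<sqsubseteq>" 50)
    and orth :: "'u \<Rightarrow> 'u \<Rightarrow> bool" (infix "\<bottom>" 50)
    and rho :: "'u \<Rightarrow> 'u \<Rightarrow> 'c set"
    and rhomap :: "'u \<Rightarrow> 'u \<Rightarrow> 'c \<Rightarrow> 'c set"
begin

definition pnest :: "'u \<Rightarrow> 'u \<Rightarrow> bool" (infix "\<sqsubset>" 50) where
  "V \<sqsubset> W \<longleftrightarrow> V \<sqsubseteq> W \<and> V \<noteq> W"

definition transverse :: "'u \<Rightarrow> 'u \<Rightarrow> bool" (infix "\<pitchfork>" 50) where
  "V \<pitchfork> W \<longleftrightarrow> V \<noteq> W \<and> \<not> V \<bottom> W \<and> \<not> V \<sqsubseteq> W \<and> \<not> W \<sqsubseteq> V"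

definition below :: "'u \<Rightarrow> 'u set" where
  "below W = {V \<in> S. V \<sqsubseteq> W}"

definition dpt :: "'u \<Rightarrow> 'x \<Rightarrow> 'x \<Rightarrow> real" where
  "dpt U x y = dC U (proj U x) (proj U y)"

definition dset :: "'u \<Rightarrow> 'x \<Rightarrow> 'c set \<Rightarrow> ennreal" where
  "dset U x A = set_dist (dC U) {proj U x} A"

end

text \<open>
  In \<open>large_links\<close> the domains \<open>T\<^sub>1, \<dots>, T\<^sub>k\<close> with \<open>k = \<lfloor>N\<rfloor>\<close> are a set of at most \<open>\<lfloor>N\<rfloor>\<close> elements. Requiring
  a list of exactly \<open>\<lfloor>N\<rfloor> \<ge> 1\<close> domains properly nested in \<open>W\<close> would be contradictory when \<open>W\<close> is
  minimal; in all other cases the two versions agree, as the list may have repetitions.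
\<close>

locale hierarchically_hyperbolic_space =
  hhs_data X dX S E C dC proj nest orth rho rhomap
  for X :: "'x set" and dX :: "'x \<Rightarrow> 'x \<Rightarrow> real"
    and S :: "'u set" and E :: real
    and C :: "'u \<Rightarrow> 'c set" and dC :: "'u \<Rightarrow> 'c \<Rightarrow> 'c \<Rightarrow> real"
    and proj :: "'u \<Rightarrow> 'x \<Rightarrow> 'c"
    and nest :: "'u \<Rightarrow> 'u \<Rightarrow> bool" (infix "\<sqsubseteq>" 50)
    and orth :: "'u \<Rightarrow> 'u \<Rightarrow> bool" (infix "\<bottom>" 50)
    and rho :: "'u \<Rightarrow> 'u \<Rightarrow> 'c set"
    and rhomap :: "'u \<Rightarrow> 'u \<Rightarrow> 'c \<Rightarrow> 'c set" +
  assumes quasigeodesic: "quasigeodesic_metric_space X dX"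
    and E_ge_1: "E \<ge> 1"
    and geodesic: "\<And>U. U \<in> S \<Longrightarrow> geodesic_metric_space (C U) (dC U)"
    and hyperbolic: "\<And>U. U \<in> S \<Longrightarrow> hyperbolic_metric_space E (C U) (dC U)"
    \<comment> \<open>projections\<close>
    and proj_in: "\<And>U x. U \<in> S \<Longrightarrow> x \<in> X \<Longrightarrow> proj U x \<in> C U"
    and proj_coarsely_lipschitz:
      "\<And>U x y. U \<in> S \<Longrightarrow> x \<in> X \<Longrightarrow> y \<in> X \<Longrightarrow> dpt U x y \<le> E * dX x y + E"
    and proj_coarsely_onto:
      "\<And>U p. U \<in> S \<Longrightarrow> p \<in> C U \<Longrightarrow> set_dist (dC U) {p} (proj U ` X) \<le> ennreal E"
    \<comment> \<open>nesting\<close>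
    and nest_refl: "reflp_on S (\<sqsubseteq>)"
    and nest_trans: "transp_on S (\<sqsubseteq>)"
    and nest_antisym: "antisymp_on S (\<sqsubseteq>)"
    and nest_unique_maximal: "S \<noteq> {} \<Longrightarrow> \<exists>!M. M \<in> S \<and> (\<forall>V\<in>S. M \<sqsubseteq> V \<longrightarrow> V = M)"
    and rho_nested:
      "\<And>V W. V \<in> S \<Longrightarrow> W \<in> S \<Longrightarrow> V \<sqsubset> W \<Longrightarrow>
         rho V W \<noteq> {} \<and> rho V W \<subseteq> C W \<and> set_diam (dC W) (rho V W) \<le> ennreal E"
    and rhomap_subset:
      "\<And>V W p. V \<in> S \<Longrightarrow> W \<in> S \<Longrightarrow> V \<sqsubset> W \<Longrightarrow> p \<in> C W \<Longrightarrow> rhomap W V p \<subseteq> C V"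
    \<comment> \<open>orthogonality\<close>
    and orth_sym: "symp_on S (\<bottom>)"
    and orth_irrefl: "irreflp_on S (\<bottom>)"
    and orth_nest:
      "\<And>U V W. U \<in> S \<Longrightarrow> V \<in> S \<Longrightarrow> W \<in> S \<Longrightarrow> V \<sqsubseteq> W \<Longrightarrow> W \<bottom> U \<Longrightarrow> V \<bottom> U"
    and orth_not_comparable:
      "\<And>V W. V \<in> S \<Longrightarrow> W \<in> S \<Longrightarrow> V \<bottom> W \<Longrightarrow> \<not> V \<sqsubseteq> W \<and> \<not> W \<sqsubseteq> V"
    and orth_container:
      "\<And>T U. T \<in> S \<Longrightarrow> U \<in> below T \<Longrightarrow> {V \<in> below T. V \<bottom> U} \<noteq> {} \<Longrightarrow>
         \<exists>W\<in>below T - {T}. \<forall>V\<in>below T. V \<bottom> U \<longrightarrow> V \<sqsubseteq> W"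
    \<comment> \<open>transversality and consistency\<close>
    and rho_transverse:
      "\<And>V W. V \<in> S \<Longrightarrow> W \<in> S \<Longrightarrow> V \<pitchfork> W \<Longrightarrow>
         rho V W \<noteq> {} \<and> rho V W \<subseteq> C W \<and> set_diam (dC W) (rho V W) \<le> ennreal E"
    and consistency_transverse:
      "\<And>V W x. V \<in> S \<Longrightarrow> W \<in> S \<Longrightarrow> V \<pitchfork> W \<Longrightarrow> x \<in> X \<Longrightarrow>
         min (dset W x (rho V W)) (dset V x (rho W V)) \<le> ennreal E"
    and consistency_nested:
      "\<And>V W x. V \<in> S \<Longrightarrow> W \<in> S \<Longrightarrow> V \<sqsubset> W \<Longrightarrow> x \<in> X \<Longrightarrow>
         min (dset W x (rho V W))
             (set_diam (dC V) ({proj V x} \<union> rhomap W V (proj W x))) \<le> ennreal E"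
    and consistency_rho:
      "\<And>U V W. U \<in> S \<Longrightarrow> V \<in> S \<Longrightarrow> W \<in> S \<Longrightarrow> U \<sqsubseteq> V \<Longrightarrow>
         V \<sqsubset> W \<or> (V \<pitchfork> W \<and> \<not> W \<bottom> U) \<Longrightarrow>
         set_dist (dC W) (rho U W) (rho V W) \<le> ennreal E"
    \<comment> \<open>finite complexity\<close>
    and finite_complexity:
      "\<exists>n::nat. \<forall>K. K \<subseteq> S \<and> (\<forall>U\<in>K. \<forall>V\<in>K. U \<sqsubseteq> V \<or> V \<sqsubseteq> U) \<longrightarrow> finite K \<and> card K \<le> n"
    \<comment> \<open>large links\<close>
    and large_links:
      "\<And>W x x' N. W \<in> S \<Longrightarrow> x \<in> X \<Longrightarrow> x' \<in> X \<Longrightarrow> N = E * dpt W x x' + E \<Longrightarrow>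
         \<exists>\<T>. \<T> \<subseteq> below W - {W} \<and> finite \<T> \<and> int (card \<T>) \<le> \<lfloor>N\<rfloor> \<and>
             (\<forall>T\<in>below W - {W}. (\<exists>T'\<in>\<T>. T \<sqsubseteq> T') \<or> dpt T x x' < E) \<and>
             (\<forall>T'\<in>\<T>. dset W x (rho T' W) \<le> ennreal N)"
    \<comment> \<open>bounded geodesic image\<close>
    and bounded_geodesic_image:
      "\<And>V W p q \<gamma>. V \<in> S \<Longrightarrow> W \<in> S \<Longrightarrow> V \<sqsubset> W \<Longrightarrow> geodesic_segment (C W) (dC W) p q \<gamma> \<Longrightarrow>
         set_diam (dC V) (\<Union>r\<in>\<gamma>. rhomap W V r) \<le> ennreal E \<or>
         (\<exists>r\<in>\<gamma>. set_dist (dC W) {r} (rho V W) \<le> ennreal E)"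
    and bounded_geodesic_image_points:
      "\<And>V W y z \<gamma>. V \<in> S \<Longrightarrow> W \<in> S \<Longrightarrow> V \<sqsubset> W \<Longrightarrow> y \<in> X \<Longrightarrow> z \<in> X \<Longrightarrow> dpt V y z > E \<Longrightarrow>
         geodesic_segment (C W) (dC W) (proj W y) (proj W z) \<gamma> \<Longrightarrow>
         set_dist (dC W) (rho V W) \<gamma> \<le> ennreal E"
    \<comment> \<open>partial realisation\<close>
    and partial_realisation:
      "\<And>\<W> p. \<W> \<subseteq> S \<Longrightarrow> pairwise (\<bottom>) \<W> \<Longrightarrow> (\<And>W. W \<in> \<W> \<Longrightarrow> p W \<in> C W) \<Longrightarrow>
         \<exists>x\<in>X. (\<forall>W\<in>\<W>. dC W (proj W x) (p W) \<le> E) \<and>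
               (\<forall>W\<in>\<W>. \<forall>V\<in>S. W \<sqsubset> V \<or> W \<pitchfork> V \<longrightarrow> dset V x (rho W V) \<le> ennreal E)"
    \<comment> \<open>uniqueness\<close>
    and uniqueness:
      "\<And>\<kappa>::real. \<exists>\<theta>::real. \<forall>x\<in>X. \<forall>y\<in>X. dX x y > \<theta> \<longrightarrow> (\<exists>U\<in>S. dpt U x y > \<kappa>)"


section \<open>Actions by automorphisms\<close>

text \<open>
  The actions \<open>act\<close> on \<open>X\<close> and \<open>dact\<close> on \<open>S\<close> are homomorphisms to \<^const>\<open>BijGroup\<close>, the group of all
  (extensional) bijections of a set. The isometry from \<open>C U\<close> to \<open>C (dact g U)\<close> is \<open>iso g U\<close>.
\<close>

locale hhs_automorphism_action =
  hierarchically_hyperbolic_space X dX S E C dC proj nest orth rho rhomap +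
  on_space: group_action H X act +
  on_domains: group_action H S dact
  for H :: "('h, 'm) monoid_scheme"
    and X :: "'x set" and dX :: "'x \<Rightarrow> 'x \<Rightarrow> real"
    and S :: "'u set" and E :: real
    and C :: "'u \<Rightarrow> 'c set" and dC :: "'u \<Rightarrow> 'c \<Rightarrow> 'c \<Rightarrow> real"
    and proj :: "'u \<Rightarrow> 'x \<Rightarrow> 'c"
    and nest :: "'u \<Rightarrow> 'u \<Rightarrow> bool" (infix "\<sqsubseteq>" 50)
    and orth :: "'u \<Rightarrow> 'u \<Rightarrow> bool" (infix "\<bottom>" 50)
    and rho :: "'u \<Rightarrow> 'u \<Rightarrow> 'c set"
    and rhomap :: "'u \<Rightarrow> 'u \<Rightarrow> 'c \<Rightarrow> 'c set"
    and act :: "'h \<Rightarrow> 'x \<Rightarrow> 'x"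
    and dact :: "'h \<Rightarrow> 'u \<Rightarrow> 'u"
    and iso :: "'h \<Rightarrow> 'u \<Rightarrow> 'c \<Rightarrow> 'c" +
  assumes act_isometry:
      "\<And>g x y. g \<in> carrier H \<Longrightarrow> x \<in> X \<Longrightarrow> y \<in> X \<Longrightarrow> dX (act g x) (act g y) = dX x y"
    and dact_nest:
      "\<And>g U V. g \<in> carrier H \<Longrightarrow> U \<in> S \<Longrightarrow> V \<in> S \<Longrightarrow> dact g U \<sqsubseteq> dact g V \<longleftrightarrow> U \<sqsubseteq> V"
    and dact_orth:
      "\<And>g U V. g \<in> carrier H \<Longrightarrow> U \<in> S \<Longrightarrow> V \<in> S \<Longrightarrow> dact g U \<bottom> dact g V \<longleftrightarrow> U \<bottom> V"
    and dact_transverse: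
      "\<And>g U V. g \<in> carrier H \<Longrightarrow> U \<in> S \<Longrightarrow> V \<in> S \<Longrightarrow> dact g U \<pitchfork> dact g V \<longleftrightarrow> U \<pitchfork> V"
    and iso_bij:
      "\<And>g U. g \<in> carrier H \<Longrightarrow> U \<in> S \<Longrightarrow> bij_betw (iso g U) (C U) (C (dact g U))"
    and iso_isometry:
      "\<And>g U p q. g \<in> carrier H \<Longrightarrow> U \<in> S \<Longrightarrow> p \<in> C U \<Longrightarrow> q \<in> C U \<Longrightarrow>
         dC (dact g U) (iso g U p) (iso g U q) = dC U p q"
    and iso_mult:
      "\<And>g h U p. g \<in> carrier H \<Longrightarrow> h \<in> carrier H \<Longrightarrow> U \<in> S \<Longrightarrow> p \<in> C U \<Longrightarrow>
         iso (g \<otimes>\<^bsub>H\<^esub> h) U p = iso g (dact h U) (iso h U p)"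
    and proj_equivariant:
      "\<And>g U x. g \<in> carrier H \<Longrightarrow> U \<in> S \<Longrightarrow> x \<in> X \<Longrightarrow>
         iso g U (proj U x) = proj (dact g U) (act g x)"
    and rho_equivariant:
      "\<And>g U V. g \<in> carrier H \<Longrightarrow> U \<in> S \<Longrightarrow> V \<in> S \<Longrightarrow> U \<pitchfork> V \<or> V \<sqsubset> U \<Longrightarrow>
         iso g U ` rho V U = rho (dact g V) (dact g U)"

definition unbounded_domains ::
  "('h, 'm) monoid_scheme \<Rightarrow> 'u set \<Rightarrow> ('u \<Rightarrow> 'c set) \<Rightarrow> ('u \<Rightarrow> 'c \<Rightarrow> 'c \<Rightarrow> real) \<Rightarrow>
   ('u \<Rightarrow> 'x \<Rightarrow> 'c) \<Rightarrow> ('h \<Rightarrow> 'x \<Rightarrow> 'x) \<Rightarrow> 'x \<Rightarrow> 'u set" where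
  "unbounded_domains H S C dC proj act x0 =
     {U \<in> S. \<not> Metric_space.mbounded (C U) (dC U) (proj U ` orbit H act x0)}"

text \<open>\<open>K\<close> is meant to be the carrier of a subgroup of \<open>G\<close>.\<close>

definition finitely_generated_in :: "('g, 'm) monoid_scheme \<Rightarrow> 'g set \<Rightarrow> bool" where
  "finitely_generated_in G K \<longleftrightarrow> (\<exists>A. finite A \<and> A \<subseteq> K \<and> generate G A = K)"

end

theory Submission
  imports Defs
begin

text \<open>
  Write \<open>\<U>\<close> for the set of domains in which the orbit of \<open>x0\<close> is unbounded. Finite complexity puts every
  member of \<open>\<U>\<close> below a maximal one, the group permutes the maximal members, and pairwise orthogonal
  sets of domains are finite because containers descend (\<open>card_orthogonal_below\<close>). So for the first
  half of the theorem everything rests on \<open>maximal_unbounded_not_transverse\<close>: two transverse members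
  of \<open>\<U>\<close> cannot both be maximal, because there is a larger member of \<open>\<U>\<close>.

  Larger domains are produced in one way only (\<open>unbounded_above_chain\<close>). Suppose that each \<open>W\<close> in a
  family \<open>\<W>\<close> has orbit points far from any given \<open>q\<close>, and that some \<open>V \<in> \<W>\<close> transverse to \<open>W\<close> has
  \<open>rho V W\<close> far from \<open>q\<close>. Then domains can be lined up one after the other, and the consistency axiom
  makes the two ends of a line of length \<open>k\<close> far apart in all \<open>k\<close> of its domains. By \<open>passing_up\<close>, which
  iterates the large link axiom, this forces domains above members of \<open>\<W>\<close> in which the orbit has
  arbitrarily large diameter.

  For \<open>\<W>\<close> take the translates of two transverse members \<open>U\<close> and \<open>V\<close> of \<open>\<U>\<close>. A point that realises \<open>U\<close>
  is at finite distance from \<open>x0\<close>, so all \<open>rho (dact g U) W\<close> lie uniformly near the projection of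
  \<open>act g x0\<close>, and the family can be continued at \<open>act g x0\<close> as soon as \<open>dact g U\<close> or \<open>dact g V\<close> is
  transverse to \<open>W\<close>. The obstruction is orthogonality. It is removed by changing \<open>g\<close> by one of finitely
  many elements (\<open>finite_nonorthogonal_translates\<close>): a maximal pairwise orthogonal set of translates
  of \<open>U\<close> is finite. The result is that the orbit has arbitrarily large diameters in domains above, say,
  \<open>U\<close>. This is not yet one domain with unbounded orbit; for \<open>unbounded_above\<close> the argument is applied again,
  to domains above translates of \<open>U\<close>, at the greatest height at which the diameters are not uniformly
  bounded. If all these diameters were finite, there would be infinitely many such domains, enough to
  form long lines, and the diameters would be unbounded at a greater height.

  For the last part, an unbounded orbit has arbitrarily large diameters in the domains by the
  uniqueness axiom. Suppose that they are all finite and take again the greatest height \<open>j\<close> at which they are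
  not uniformly bounded. Only finitely many domains of height \<open>j\<close> notice the move of \<open>x0\<close> by a short
  word in the generators, so when the diameter of \<open>W\<close> is large, short words move \<open>x0\<close> by less than \<open>E\<close> in all
  translates of \<open>W\<close>. If every translate were transverse to one of its neighbours, the family of all
  translates would again form long lines (\<open>slow_tame_translate\<close>). So, up to translation, short words
  move \<open>W\<close> only to \<open>W\<close> itself or to orthogonal domains, and the orbit of \<open>W\<close> under all words is finite.
  Two such domains that are transverse to each other are fixed by a finite-index subgroup of the group
  of words, which also preserves their \<open>rho\<close> sets; as \<open>x0\<close> is near one of the two \<open>rho\<close> sets, the orbit has small diameter in that domain
  (\<open>tame_pair_bounded\<close>), which is absurd. And two of them are transverse, because infinitely many
  domains cannot be pairwise orthogonal.
\<close>

(* These symbols denote the relations between domains below. *)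
no_notation gorder.le (infixl \<open>\<sqsubseteq>\<index>\<close> 50)
no_notation lless (infixl \<open>\<sqsubset>\<index>\<close> 50)
no_notation bottom (\<open>\<bottom>\<index>\<close>)

section \<open>Infimal distances and diameters in real terms\<close>

lemma set_dist_leD:
  assumes "set_dist d A B \<le> ennreal r" "0 \<le> r" "0 < e"
  shows "\<exists>a\<in>A. \<exists>b\<in>B. d a b < r + e"
proof -
  have "set_dist d A B < ennreal (r + e)"
    using assms by (auto intro: le_less_trans simp: ennreal_less_iff)
  then obtain a b where "a \<in> A" "b \<in> B" "ennreal (d a b) < ennreal (r + e)"
    by (auto simp: set_dist_def INF_less_iff)
  then have "d a b < r + e"
    using assms by (metis add_nonneg_pos ennreal_leI leD leI)
  with \<open>a \<in> A\<close> \<open>b \<in> B\<close> show ?thesis by blast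
qed

lemma set_diam_leD:
  assumes "set_diam d A \<le> ennreal r" "0 \<le> r" "a \<in> A" "b \<in> A"
  shows "d a b \<le> r"
proof -
  have "ennreal (d a b) \<le> (SUP b\<in>A. ennreal (d a b))"
    using assms by (intro SUP_upper)
  also have "\<dots> \<le> set_diam d A"
    unfolding set_diam_def using assms(3) by (rule SUP_upper)
  also have "\<dots> \<le> ennreal r" by (rule assms)
  finally show ?thesis using assms(2) by (simp add: ennreal_le_iff)
qed


section \<open>Heights, orthogonal families and passing up\<close>

context hierarchically_hyperbolic_space
begin

lemma C_metric: "U \<in> S \<Longrightarrow> Metric_space (C U) (dC U)"
  using geodesic by (auto simp: geodesic_metric_space_def)

lemma X_metric: "Metric_space X dX"
  using quasigeodesic by (auto simp: quasigeodesic_metric_space_def)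

lemma dC_triangle:
  "U \<in> S \<Longrightarrow> p \<in> C U \<Longrightarrow> q \<in> C U \<Longrightarrow> r \<in> C U \<Longrightarrow> dC U p r \<le> dC U p q + dC U q r"
  using Metric_space.triangle[OF C_metric] by blast

lemma dC_commute: "U \<in> S \<Longrightarrow> dC U p q = dC U q p"
  using Metric_space.commute[OF C_metric] by blast

lemma nest_reflD: "U \<in> S \<Longrightarrow> U \<sqsubseteq> U"
  using nest_refl by (auto simp: reflp_on_def)

lemma nest_transD: "U \<in> S \<Longrightarrow> V \<in> S \<Longrightarrow> W \<in> S \<Longrightarrow> U \<sqsubseteq> V \<Longrightarrow> V \<sqsubseteq> W \<Longrightarrow> U \<sqsubseteq> W"
  using nest_trans unfolding transp_on_def by blast

lemma nest_antisymD: "U \<in> S \<Longrightarrow> V \<in> S \<Longrightarrow> U \<sqsubseteq> V \<Longrightarrow> V \<sqsubseteq> U \<Longrightarrow> U = V"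
  using nest_antisym unfolding antisymp_on_def by blast

lemma orth_symD: "U \<in> S \<Longrightarrow> V \<in> S \<Longrightarrow> U \<bottom> V \<Longrightarrow> V \<bottom> U"
  using orth_sym unfolding symp_on_def by blast

lemma orth_irreflD: "U \<in> S \<Longrightarrow> \<not> U \<bottom> U"
  using orth_irrefl by (auto simp: irreflp_on_def)

lemma transverse_sym: "U \<in> S \<Longrightarrow> V \<in> S \<Longrightarrow> U \<pitchfork> V \<Longrightarrow> V \<pitchfork> U"
  using orth_symD by (auto simp: transverse_def)

lemma orth_nest2:
  assumes "U \<in> S" "V \<in> S" "U' \<in> S" "V' \<in> S" "U \<sqsubseteq> U'" "V \<sqsubseteq> V'" "U' \<bottom> V'"
  shows "U \<bottom> V"
  using assms orth_nest orth_symD by meson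

definition nest_chain :: "'u set \<Rightarrow> bool" where
  "nest_chain K \<longleftrightarrow> (\<forall>U\<in>K. \<forall>V\<in>K. U \<sqsubseteq> V \<or> V \<sqsubseteq> U)"

definition height :: "'u \<Rightarrow> nat" where
  "height W = Max (card ` {K. K \<subseteq> below W \<and> nest_chain K})"

lemma nest_chain_bounded: "\<exists>n. \<forall>K W. K \<subseteq> below W \<longrightarrow> nest_chain K \<longrightarrow> finite K \<and> card K \<le> n"
proof -
  from finite_complexity obtain n where
    n: "\<And>K. K \<subseteq> S \<Longrightarrow> \<forall>U\<in>K. \<forall>V\<in>K. U \<sqsubseteq> V \<or> V \<sqsubseteq> U \<Longrightarrow> finite K \<and> card K \<le> n" by metis
  have "finite K \<and> card K \<le> n" if "K \<subseteq> below W" "nest_chain K" for K W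
    using that by (intro n) (auto simp: nest_chain_def below_def)
  then show ?thesis by metis
qed

lemma finite_chain_cards: "finite (card ` {K. K \<subseteq> below W \<and> nest_chain K})"
proof -
  obtain n where "\<And>K. K \<subseteq> below W \<Longrightarrow> nest_chain K \<Longrightarrow> card K \<le> n"
    using nest_chain_bounded by metis
  then have "card ` {K. K \<subseteq> below W \<and> nest_chain K} \<subseteq> {..n}"
    by (intro image_subsetI) simp
  then show ?thesis by (rule finite_subset) simp
qed

lemma card_chain_le_height:
  assumes "K \<subseteq> below W" "nest_chain K"
  shows "card K \<le> height W"
  unfolding height_def using assms by (intro Max_ge[OF finite_chain_cards]) simp

lemma height_chain:
  obtains K where "K \<subseteq> below W" "nest_chain K" "card K = height W" "finite K"
proof -
  have "{} \<in> {K. K \<subseteq> below W \<and> nest_chain K}" by (simp add: nest_chain_def)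
  then have "height W \<in> card ` {K. K \<subseteq> below W \<and> nest_chain K}"
    unfolding height_def by (intro Max_in[OF finite_chain_cards]) blast
  then obtain K where K: "K \<subseteq> below W" "nest_chain K" "card K = height W" by force
  moreover have "finite K" using nest_chain_bounded K(1,2) by metis
  ultimately show ?thesis using that by metis
qed

lemma height_bounded: "\<exists>n. \<forall>W. height W \<le> n"
proof -
  obtain n where n: "\<And>K W. K \<subseteq> below W \<Longrightarrow> nest_chain K \<Longrightarrow> card K \<le> n"
    using nest_chain_bounded by metis
  have "height W \<le> n" for W
    using height_chain[of W] n by metis
  then show ?thesis by blast
qed

lemma height_strict_mono:
  assumes "U \<in> S" "V \<in> S" "U \<sqsubset> V"
  shows "height U < height V"
proof -
  obtain K where K: "K \<subseteq> below U" "nest_chain K" "card K = height U" "finite K"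
    by (rule height_chain)
  have sub: "W \<sqsubseteq> V \<and> W \<in> S" if "W \<in> K" for W
    using that K(1) assms nest_transD[of W U V] by (auto simp: below_def pnest_def)
  have "V \<notin> K"
    using K(1) assms nest_antisymD by (auto simp: below_def pnest_def)
  then have "card (insert V K) = Suc (height U)" using K by simp
  moreover have "card (insert V K) \<le> height V"
  proof (rule card_chain_le_height)
    show "insert V K \<subseteq> below V" using sub assms nest_reflD by (auto simp: below_def)
    show "nest_chain (insert V K)"
      using K(2) sub assms(2) nest_reflD by (auto simp: nest_chain_def)
  qed
  ultimately show ?thesis by simp
qed

lemma height_pos: "U \<in> S \<Longrightarrow> 0 < height U"
  using card_chain_le_height[of "{U}" U] nest_reflD by (auto simp: below_def nest_chain_def)

lemma same_height_nest_eq: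
  "U \<in> S \<Longrightarrow> V \<in> S \<Longrightarrow> height U = height V \<Longrightarrow> U \<sqsubseteq> V \<Longrightarrow> U = V"
  using height_strict_mono[of U V] by (auto simp: pnest_def)

lemma transverse_if_same_height:
  "U \<in> S \<Longrightarrow> V \<in> S \<Longrightarrow> height U = height V \<Longrightarrow> U \<noteq> V \<Longrightarrow> \<not> U \<bottom> V \<Longrightarrow> U \<pitchfork> V"
  using same_height_nest_eq[of U V] same_height_nest_eq[of V U] by (auto simp: transverse_def)

text \<open>A domain of greatest height among those above \<open>U\<close> is maximal.\<close>

lemma exists_maximal_above:
  assumes "\<U> \<subseteq> S" "U \<in> \<U>"
  shows "\<exists>W\<in>\<U>. U \<sqsubseteq> W \<and> (\<forall>V\<in>\<U>. W \<sqsubseteq> V \<longrightarrow> V = W)"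
proof -
  obtain n where n: "\<forall>W. height W \<le> n" using height_bounded by blast
  define A where "A = {V \<in> \<U>. U \<sqsubseteq> V}"
  have "U \<in> A" using assms nest_reflD by (auto simp: A_def)
  moreover have fin: "finite (height ` A)"
    by (rule finite_subset[of _ "{..n}"]) (use n in auto)
  ultimately have "Max (height ` A) \<in> height ` A" by (intro Max_in) auto
  then obtain W where W: "W \<in> A" "height W = Max (height ` A)" by force
  have le: "height V \<le> height W" if "V \<in> A" for V
    using that fin W(2) by simp
  have "V = W" if "V \<in> \<U>" "W \<sqsubseteq> V" for V
  proof -
    have "V \<in> A" using that W assms nest_transD[of U W V] by (auto simp: A_def)
    moreover from this have "\<not> W \<sqsubset> V" using le[of V] height_strict_mono[of W V] W(1) assms(1)
      by (auto simp: A_def)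
    ultimately show ?thesis using that(2) by (auto simp: pnest_def)
  qed
  then show ?thesis using W(1) by (intro bexI[of _ W]) (auto simp: A_def)
qed

lemma top_domain:
  assumes "S \<noteq> {}"
  obtains T where "T \<in> S" "\<And>V. V \<in> S \<Longrightarrow> V \<sqsubseteq> T"
proof -
  obtain T where T: "T \<in> S" "\<And>M. M \<in> S \<Longrightarrow> (\<forall>V\<in>S. M \<sqsubseteq> V \<longrightarrow> V = M) \<Longrightarrow> M = T"
    using nest_unique_maximal[OF assms] by blast
  have "V \<sqsubseteq> T" if "V \<in> S" for V
    using exists_maximal_above[of S V] T that by blast
  with T that show ?thesis by blast
qed

text \<open>
  Removing one member \<open>U\<close> from a pairwise orthogonal family in \<open>below T\<close> leaves a family nested in
  the container of the orthogonal complement of \<open>U\<close>, which is properly nested in \<open>T\<close>: the height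
  drops with each removal.
\<close>

lemma card_orthogonal_below:
  assumes "T \<in> S" "\<W> \<subseteq> below T" "pairwise (\<bottom>) \<W>"
  shows "finite \<W> \<and> card \<W> \<le> height T"
  using assms
proof (induction "height T" arbitrary: T \<W> rule: less_induct)
  case less
  show ?case
  proof (cases "\<exists>U. \<W> \<subseteq> {U}")
    case True
    then show ?thesis using height_pos[OF less.prems(1)] by (auto simp: subset_singleton_iff)
  next
    case False
    then obtain U where U: "U \<in> \<W>" "\<W> - {U} \<noteq> {}" by blast
    have orth: "V \<bottom> U" if "V \<in> \<W> - {U}" for V
      using less.prems that U by (auto simp: pairwise_def)
    have "{V \<in> below T. V \<bottom> U} \<noteq> {}"
      using orth U less.prems by blast
    then obtain W where W: "W \<in> below T - {T}" "\<forall>V\<in>below T. V \<bottom> U \<longrightarrow> V \<sqsubseteq> W"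
      using orth_container[OF less.prems(1), of U] U less.prems by blast
    have h: "height W < height T"
      using W less.prems by (intro height_strict_mono) (auto simp: below_def pnest_def)
    have "finite (\<W> - {U}) \<and> card (\<W> - {U}) \<le> height W"
    proof (rule less.hyps[OF h])
      show "\<W> - {U} \<subseteq> below W"
        using W(2) orth less.prems(2) by (auto simp: below_def)
    qed (use W less.prems in \<open>auto simp: below_def pairwise_def\<close>)
    then show ?thesis using h U(1) by (auto simp: card_Diff_singleton)
  qed
qed

lemma card_orthogonal_bounded:
  "\<exists>c. \<forall>\<W>. \<W> \<subseteq> S \<and> pairwise (\<bottom>) \<W> \<longrightarrow> finite \<W> \<and> card \<W> \<le> c"
proof (cases "S = {}")
  case False
  then obtain T where T: "T \<in> S" "\<And>V. V \<in> S \<Longrightarrow> V \<sqsubseteq> T" using top_domain by metis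
  then have "below T = S" by (auto simp: below_def)
  then show ?thesis using card_orthogonal_below[OF T(1)] by auto
qed auto

definition visible_below :: "real \<Rightarrow> 'x \<Rightarrow> 'x \<Rightarrow> 'u set \<Rightarrow> bool" where
  "visible_below M x y \<D> \<longleftrightarrow>
     \<D> \<subseteq> S \<and> (\<forall>D\<in>\<D>. E \<le> dpt D x y \<and> (\<forall>V\<in>S. D \<sqsubset> V \<longrightarrow> dpt V x y \<le> M))"

text \<open>
  If no domain above a member of \<open>\<D>\<close> sees a distance larger than \<open>M\<close> between \<open>x\<close> and
  \<open>y\<close>, then the large link axiom covers \<open>\<D> - {T}\<close> by boundedly many \<open>below T'\<close> with \<open>T'\<close> properly
  nested in \<open>T\<close>, and the count proceeds by induction on the height.
\<close>

lemma passing_up_below: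
  "\<exists>P. \<forall>T x y \<D>. T \<in> S \<longrightarrow> x \<in> X \<longrightarrow> y \<in> X \<longrightarrow> \<D> \<subseteq> below T \<longrightarrow> height T \<le> n \<longrightarrow>
    visible_below M x y \<D> \<longrightarrow> finite \<D> \<and> card \<D> \<le> P"
proof (induction n)
  case 0
  have "\<not> height T \<le> 0" if "T \<in> S" for T using height_pos[OF that] by simp
  then show ?case by metis
next
  case (Suc n)
  then obtain P where P: "\<And>T x y \<D>. T \<in> S \<Longrightarrow> x \<in> X \<Longrightarrow> y \<in> X \<Longrightarrow> \<D> \<subseteq> below T \<Longrightarrow>
    height T \<le> n \<Longrightarrow> visible_below M x y \<D> \<Longrightarrow> finite \<D> \<and> card \<D> \<le> P" by metis
  define m where "m = nat \<lfloor>E * M + E\<rfloor>"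
  show ?case
  proof (intro exI[of _ "Suc (m * P)"] allI impI)
    fix T x y \<D>
    assume T: "T \<in> S" and x: "x \<in> X" and y: "y \<in> X" and sub: "\<D> \<subseteq> below T"
      and h: "height T \<le> Suc n" and vis: "visible_below M x y \<D>"
    show "finite \<D> \<and> card \<D> \<le> Suc (m * P)"
    proof (cases "\<D> \<subseteq> {T}")
      case True
      then show ?thesis by (auto simp: subset_singleton_iff)
    next
      case False
      then obtain D0 where D0: "D0 \<in> \<D>" "D0 \<noteq> T" by blast
      then have "D0 \<sqsubset> T" using sub by (auto simp: below_def pnest_def)
      then have dT: "dpt T x y \<le> M" using vis D0(1) T unfolding visible_below_def by blast
      obtain \<T> where \<T>: "\<T> \<subseteq> below T - {T}" "finite \<T>" "int (card \<T>) \<le> \<lfloor>E * dpt T x y + E\<rfloor>"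
        "\<forall>D\<in>below T - {T}. (\<exists>T'\<in>\<T>. D \<sqsubseteq> T') \<or> dpt D x y < E"
        using large_links[OF T x y refl] by blast
      have "E * dpt T x y + E \<le> E * M + E" using dT E_ge_1 by simp
      then have card\<T>: "card \<T> \<le> m" using \<T>(3) unfolding m_def by linarith
      define part where "part T' = {D \<in> \<D>. D \<sqsubseteq> T'}" for T'
      have part: "finite (part T') \<and> card (part T') \<le> P" if T': "T' \<in> \<T>" for T'
      proof (rule P[OF _ x y])
        show "T' \<in> S" using T' \<T>(1) by (auto simp: below_def)
        have "T' \<sqsubset> T" using T' \<T>(1) by (auto simp: below_def pnest_def)
        then show "height T' \<le> n" using height_strict_mono[OF \<open>T' \<in> S\<close> T] h by simp
        show "part T' \<subseteq> below T'" using sub by (auto simp: part_def below_def)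
        show "visible_below M x y (part T')" using vis by (auto simp: part_def visible_below_def)
      qed
      have cover: "\<D> \<subseteq> insert T (\<Union>T'\<in>\<T>. part T')"
      proof
        fix D assume D: "D \<in> \<D>"
        show "D \<in> insert T (\<Union>T'\<in>\<T>. part T')"
        proof (cases "D = T")
          case False
          then have "D \<in> below T - {T}" "\<not> dpt D x y < E"
            using D sub vis by (auto simp: visible_below_def)
          then show ?thesis using \<T>(4) D unfolding part_def by blast
        qed simp
      qed
      have fin: "finite (\<Union>T'\<in>\<T>. part T')" using part \<T>(2) by blast
      have "card (\<Union>T'\<in>\<T>. part T') \<le> (\<Sum>T'\<in>\<T>. card (part T'))"
        using \<T>(2) by (rule card_UN_le)
      also have "\<dots> \<le> card \<T> * P" using part sum_bounded_above[of \<T> "\<lambda>T'. card (part T')" P] by simp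
      also have "\<dots> \<le> m * P" using card\<T> by simp
      finally have "card (insert T (\<Union>T'\<in>\<T>. part T')) \<le> Suc (m * P)"
        using fin by (simp add: card_insert_if)
      moreover have "card \<D> \<le> card (insert T (\<Union>T'\<in>\<T>. part T'))"
        using fin cover by (intro card_mono) auto
      moreover have "finite \<D>" using cover fin by (meson finite_insert finite_subset)
      ultimately show ?thesis by simp
    qed
  qed
qed

lemma passing_up:
  "\<exists>P. \<forall>x\<in>X. \<forall>y\<in>X. \<forall>\<D>. visible_below M x y \<D> \<longrightarrow> finite \<D> \<and> card \<D> \<le> P"
proof (cases "S = {}")
  case True
  have "\<D> = {}" if "visible_below M x y \<D>" for x y \<D>
    using that True unfolding visible_below_def by blast
  then show ?thesis by (metis card.empty finite.emptyI order_refl)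
next
  case False
  then obtain T where T: "T \<in> S" "\<And>V. V \<in> S \<Longrightarrow> V \<sqsubseteq> T" using top_domain by metis
  have "\<D> \<subseteq> below T" if "visible_below M x y \<D>" for x y \<D>
    using that T by (auto simp: visible_below_def below_def)
  then show ?thesis using passing_up_below[of "height T" M] T(1) by (meson order_refl)
qed

end

section \<open>Chains of transverse domains\<close>

context hierarchically_hyperbolic_space
begin

text \<open>
  Sets of bounded diameter are treated as coarse points: \<open>near\<close> bounds the distance to all of their
  points.
\<close>

definition near :: "real \<Rightarrow> 'u \<Rightarrow> 'x \<Rightarrow> 'c set \<Rightarrow> bool" where
  "near r W x A \<longleftrightarrow> (\<forall>p\<in>A. dC W (proj W x) p \<le> r)"

lemma E_nonneg: "0 \<le> E"
  using E_ge_1 by simp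

lemma nearD: "near r W x A \<Longrightarrow> p \<in> A \<Longrightarrow> dC W (proj W x) p \<le> r"
  by (simp add: near_def)

lemma dset_le_near:
  assumes W: "W \<in> S" and x: "x \<in> X" and A: "A \<subseteq> C W" "set_diam (dC W) A \<le> ennreal E"
    and d: "dset W x A \<le> ennreal E"
  shows "near (2 * E) W x A"
  unfolding near_def
proof (rule ballI, rule field_le_epsilon)
  fix p and e :: real assume p: "p \<in> A" and e: "0 < e"
  obtain b where b: "b \<in> A" "dC W (proj W x) b < E + e"
    using set_dist_leD[OF d[unfolded dset_def] E_nonneg e] by blast
  moreover have "dC W b p \<le> E" using set_diam_leD[OF A(2) E_nonneg b(1) p] .
  moreover have "dC W (proj W x) p \<le> dC W (proj W x) b + dC W b p"
    using A(1) b(1) p by (intro dC_triangle proj_in W x) auto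
  ultimately show "dC W (proj W x) p \<le> 2 * E + e" by simp
qed

lemma transverse_near:
  assumes "V \<in> S" "W \<in> S" "V \<pitchfork> W" "x \<in> X"
  shows "near (2 * E) W x (rho V W) \<or> near (2 * E) V x (rho W V)"
proof -
  have "dset W x (rho V W) \<le> ennreal E \<or> dset V x (rho W V) \<le> ennreal E"
    using consistency_transverse[OF assms] by (auto simp: min_def split: if_splits)
  then show ?thesis
    using dset_le_near rho_transverse assms transverse_sym by meson
qed

lemma dpt_commute: "W \<in> S \<Longrightarrow> dpt W x y = dpt W y x"
  unfolding dpt_def by (rule dC_commute)

lemma dpt_via:
  "W \<in> S \<Longrightarrow> x \<in> X \<Longrightarrow> y \<in> X \<Longrightarrow> p \<in> C W \<Longrightarrow>
    dpt W x y \<le> dC W (proj W x) p + dC W (proj W y) p"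
  unfolding dpt_def by (metis dC_triangle dC_commute proj_in)

lemma dC_proj_shift:
  "W \<in> S \<Longrightarrow> x \<in> X \<Longrightarrow> y \<in> X \<Longrightarrow> p \<in> C W \<Longrightarrow>
    dC W (proj W x) p \<le> dC W (proj W y) p + dpt W x y"
  unfolding dpt_def by (smt (verit) dC_triangle dC_commute proj_in)

text \<open>The set \<open>Y\<close> will be an orbit, and \<open>\<not> oscillates Y W L\<close> a bound on the diameter of its image.\<close>

definition oscillates :: "'x set \<Rightarrow> 'u \<Rightarrow> real \<Rightarrow> bool" where
  "oscillates Y W L \<longleftrightarrow> (\<exists>x\<in>Y. \<exists>y\<in>Y. L < dpt W x y)"

lemma oscillates_mono: "oscillates Y W L \<Longrightarrow> L' \<le> L \<Longrightarrow> oscillates Y W L'"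
  unfolding oscillates_def by force

lemma oscillates_far_point:
  assumes "oscillates Y W (2 * L)" "Y \<subseteq> X" "W \<in> S" "q \<in> C W"
  shows "\<exists>y\<in>Y. L < dC W q (proj W y)"
proof -
  obtain x y where xy: "x \<in> Y" "y \<in> Y" "2 * L < dpt W x y"
    using assms(1) by (auto simp: oscillates_def)
  then have "dpt W x y \<le> dC W (proj W x) q + dC W (proj W y) q"
    using assms by (intro dpt_via) auto
  then have "L < dC W q (proj W x) \<or> L < dC W q (proj W y)"
    using xy(3) dC_commute[OF assms(3), of q "proj W x"] dC_commute[OF assms(3), of q "proj W y"]
    by linarith
  then show ?thesis using xy by blast
qed

text \<open>
  The chain is grown at its start: given a chain \<open>\<D>'\<close> which starts at \<open>V\<close> near
  \<open>q' \<in> rho W V\<close> and ends at \<open>y\<close>, consistency forces any point near \<open>q\<close> in \<open>W\<close> to be near \<open>q'\<close> in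
  \<open>V\<close> (as \<open>rho V W\<close> is far from \<open>q\<close>), hence to be far from \<open>y\<close> in every member of \<open>\<D>'\<close>; and it forces
  \<open>y\<close>, which is far from \<open>q'\<close> in \<open>V\<close>, to be near \<open>rho V W\<close> in \<open>W\<close>. A point that realises \<open>q'\<close> in \<open>V\<close>
  is near \<open>rho V W\<close> as well, so \<open>W\<close> does not separate it from \<open>y\<close>, while all of \<open>\<D>'\<close> does; this is
  why \<open>W\<close> is new. The constants decrease because consistency locates points only up to \<open>2 * E\<close>.
\<close>

lemma transverse_chain:
  assumes "Y \<subseteq> X" "\<W> \<subseteq> S"
    and far: "\<And>W q. W \<in> \<W> \<Longrightarrow> q \<in> C W \<Longrightarrow> \<exists>y\<in>Y. 8 * E < dC W q (proj W y)"
    and nxt: "\<And>W q. W \<in> \<W> \<Longrightarrow> q \<in> C W \<Longrightarrow>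
      \<exists>V\<in>\<W>. V \<pitchfork> W \<and> (\<forall>p\<in>rho V W. 8 * E < dC W q p)"
    and "W \<in> \<W>" "q \<in> C W"
  shows "\<exists>y\<in>Y. \<exists>\<D>\<subseteq>\<W>. finite \<D> \<and> card \<D> = k \<and> 6 * E < dC W q (proj W y) \<and>
    (\<forall>x\<in>X. dC W (proj W x) q \<le> 2 * E \<longrightarrow> (\<forall>D\<in>\<D>. 4 * E < dpt D x y))"
  using assms(5,6)
proof (induction k arbitrary: W q)
  case 0
  obtain y where y: "y \<in> Y" "8 * E < dC W q (proj W y)" using far[OF 0] by blast
  then have "6 * E < dC W q (proj W y)" using E_ge_1 by simp
  then show ?case using y(1) by (intro bexI[of _ y] exI[of _ "{}"]) simp_all
next
  case (Suc k)
  have W: "W \<in> S" using Suc.prems assms(2) by blast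
  obtain V where V: "V \<in> \<W>" "V \<pitchfork> W" "\<And>p. p \<in> rho V W \<Longrightarrow> 8 * E < dC W q p"
    using nxt[OF Suc.prems] by blast
  have VS: "V \<in> S" using V assms(2) by blast
  have WV: "W \<pitchfork> V" using transverse_sym[OF VS W V(2)] .
  have rVW: "rho V W \<subseteq> C W" and rWV: "rho W V \<subseteq> C V"
    using rho_transverse VS W V(2) WV by blast+
  obtain p0 where p0: "p0 \<in> rho V W" using rho_transverse[OF VS W V(2)] by blast
  obtain q' where q': "q' \<in> rho W V" using rho_transverse[OF W VS WV] by blast
  have p0C: "p0 \<in> C W" and q'C: "q' \<in> C V" using p0 q' rVW rWV by auto
  obtain y \<D> where y: "y \<in> Y" and \<D>: "\<D> \<subseteq> \<W>" "finite \<D>" "card \<D> = k"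
    and yV: "6 * E < dC V q' (proj V y)"
    and sep: "\<And>x D. x \<in> X \<Longrightarrow> dC V (proj V x) q' \<le> 2 * E \<Longrightarrow> D \<in> \<D> \<Longrightarrow> 4 * E < dpt D x y"
    using Suc.IH[OF V(1) q'C] by metis
  have yX: "y \<in> X" using y assms(1) by blast
  have nearWV: "dC V (proj V x) q' \<le> 2 * E \<or> dC W (proj W x) p0 \<le> 2 * E" if "x \<in> X" for x
    using transverse_near[OF VS W V(2) that] nearD p0 q' by metis
  have "dC W (proj W y) p0 \<le> 2 * E"
    using nearWV[OF yX] yV dC_commute[OF VS, of q'] E_ge_1 by auto
  then have yp0: "dC W (proj W y) p0 \<le> 2 * E" .
  have "dC W q p0 \<le> dC W q (proj W y) + dC W (proj W y) p0"
    by (intro dC_triangle W Suc.prems proj_in yX p0C)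
  then have yW: "6 * E < dC W q (proj W y)" using yp0 V(3)[OF p0] by linarith
  have sepW: "4 * E < dpt W x y" if x: "x \<in> X" "dC W (proj W x) q \<le> 2 * E" for x
  proof -
    have "dC W q (proj W y) \<le> dC W q (proj W x) + dpt W x y"
      unfolding dpt_def by (intro dC_triangle W Suc.prems proj_in yX x)
    then show ?thesis using yW x(2) dC_commute[OF W, of q] by simp
  qed
  have sep\<D>: "4 * E < dpt D x y" if x: "x \<in> X" "dC W (proj W x) q \<le> 2 * E" and "D \<in> \<D>" for x D
  proof -
    have "dC W q p0 \<le> dC W q (proj W x) + dC W (proj W x) p0"
      by (intro dC_triangle W Suc.prems proj_in x p0C)
    then have "\<not> dC W (proj W x) p0 \<le> 2 * E"
      using V(3)[OF p0] x(2) dC_commute[OF W, of q] E_ge_1 by (smt (verit))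
    then show ?thesis using nearWV[OF x(1)] sep x(1) \<open>D \<in> \<D>\<close> by blast
  qed
  have "W \<notin> \<D>"
  proof
    (* u realises q' in V: all of \<D> separates u from y, but both are near rho V W in W. *)
    assume "W \<in> \<D>"
    obtain u where u: "u \<in> X" "dC V (proj V u) q' \<le> E" "dset W u (rho V W) \<le> ennreal E"
      using partial_realisation[of "{V}" "\<lambda>_. q'"] VS W V(2) q'C by auto
    have "4 * E < dpt W u y" using sep[of u W] u \<open>W \<in> \<D>\<close> E_ge_1 by simp
    moreover have "near (2 * E) W u (rho V W)"
      using rho_transverse[OF VS W V(2)] u by (intro dset_le_near W) auto
    then have "dC W (proj W u) p0 \<le> 2 * E" using p0 nearD by blast
    ultimately show False using dpt_via[OF W u(1) yX p0C] yp0 by simp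
  qed
  then have "card (insert W \<D>) = Suc k" using \<D> by simp
  then show ?case
    using y \<D> yW sepW sep\<D> Suc.prems by (intro bexI[of _ y] exI[of _ "insert W \<D>"]) auto
qed

text \<open>
  The ends of a chain with more members than the count in \<open>passing_up\<close> allows must be further than
  \<open>M\<close> apart in a domain above one of the members.
\<close>

lemma unbounded_above_chain:
  assumes "Y \<subseteq> X" "Y \<noteq> {}" "\<W> \<subseteq> S" "\<W> \<noteq> {}"
    and far: "\<And>W q. W \<in> \<W> \<Longrightarrow> q \<in> C W \<Longrightarrow> \<exists>y\<in>Y. 8 * E < dC W q (proj W y)"
    and nxt: "\<And>W q. W \<in> \<W> \<Longrightarrow> q \<in> C W \<Longrightarrow>
      \<exists>V\<in>\<W>. V \<pitchfork> W \<and> (\<forall>p\<in>rho V W. 8 * E < dC W q p)"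
  shows "\<exists>W\<in>\<W>. \<exists>V\<in>S. W \<sqsubset> V \<and> oscillates Y V M"
proof (rule ccontr)
  assume no: "\<not> ?thesis"
  obtain P where P: "\<And>x y \<D>. x \<in> X \<Longrightarrow> y \<in> X \<Longrightarrow> visible_below M x y \<D> \<Longrightarrow> card \<D> \<le> P"
    using passing_up[of M] by blast
  obtain x W where x: "x \<in> Y" and W: "W \<in> \<W>" using assms by blast
  have xX: "x \<in> X" and WS: "W \<in> S" using x W assms by auto
  have "dC W (proj W x) (proj W x) \<le> 2 * E"
    using Metric_space.mdist_zero[OF C_metric[OF WS]] proj_in[OF WS xX] E_ge_1 by simp
  then obtain y \<D> where y: "y \<in> Y" and \<D>: "\<D> \<subseteq> \<W>" "card \<D> = Suc P" "\<And>D. D \<in> \<D> \<Longrightarrow> 4 * E < dpt D x y"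
    using transverse_chain[OF assms(1,3) far nxt W proj_in[OF WS xX], of "Suc P"] xX by blast
  have "visible_below M x y \<D>"
    unfolding visible_below_def
  proof (intro conjI ballI impI)
    show "\<D> \<subseteq> S" using \<D> assms by blast
    show "E \<le> dpt D x y" if "D \<in> \<D>" for D using \<D>(3)[OF that] E_ge_1 by simp
    show "dpt V x y \<le> M" if "D \<in> \<D>" "V \<in> S" "D \<sqsubset> V" for D V
      using no that \<D>(1) x y unfolding oscillates_def by force
  qed
  then show False using P[OF xX, of y \<D>] y assms(1) \<D>(2) by auto
qed

end

section \<open>Equivariance\<close>

locale pointed_hhs_action = hhs_automorphism_action +
  fixes x0
  assumes x0_in: "x0 \<in> X"
begin

abbreviation Y where "Y \<equiv> orbit H act x0"

abbreviation unbounded where "unbounded \<equiv> unbounded_domains H S C dC proj act x0"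

sublocale grp: group H
  using on_space.group_hom by (simp add: group_hom_def)

lemma act_in: "g \<in> carrier H \<Longrightarrow> x \<in> X \<Longrightarrow> act g x \<in> X"
  using on_space.element_image by blast

lemma dact_in: "g \<in> carrier H \<Longrightarrow> U \<in> S \<Longrightarrow> dact g U \<in> S"
  using on_domains.element_image by blast

lemma act_mult:
  "g \<in> carrier H \<Longrightarrow> h \<in> carrier H \<Longrightarrow> x \<in> X \<Longrightarrow> act (g \<otimes>\<^bsub>H\<^esub> h) x = act g (act h x)"
  using on_space.composition_rule by blast

lemma dact_mult:
  "g \<in> carrier H \<Longrightarrow> h \<in> carrier H \<Longrightarrow> U \<in> S \<Longrightarrow> dact (g \<otimes>\<^bsub>H\<^esub> h) U = dact g (dact h U)"
  using on_domains.composition_rule by blast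

lemma act_one: "x \<in> X \<Longrightarrow> act \<one>\<^bsub>H\<^esub> x = x"
  using on_space.id_eq_one by (metis restrict_apply')

lemma dact_one: "U \<in> S \<Longrightarrow> dact \<one>\<^bsub>H\<^esub> U = U"
  using on_domains.id_eq_one by (metis restrict_apply')

lemma dact_inv: "g \<in> carrier H \<Longrightarrow> U \<in> S \<Longrightarrow> dact (inv\<^bsub>H\<^esub> g) (dact g U) = U"
  by (metis dact_mult dact_one grp.inv_closed grp.l_inv)

lemma dact_inv': "g \<in> carrier H \<Longrightarrow> U \<in> S \<Longrightarrow> dact g (dact (inv\<^bsub>H\<^esub> g) U) = U"
  by (metis dact_mult dact_one grp.inv_closed grp.r_inv)

lemma dact_eq_iff:
  "g \<in> carrier H \<Longrightarrow> U \<in> S \<Longrightarrow> V \<in> S \<Longrightarrow> dact g U = dact g V \<longleftrightarrow> U = V"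
  by (metis dact_inv)

lemma dact_pnest:
  "g \<in> carrier H \<Longrightarrow> U \<in> S \<Longrightarrow> V \<in> S \<Longrightarrow> dact g U \<sqsubset> dact g V \<longleftrightarrow> U \<sqsubset> V"
  by (simp add: pnest_def dact_nest dact_eq_iff)

lemma orbit_subset: "Y \<subseteq> X"
  using act_in x0_in by (auto simp: orbit_def)

lemma orbit_memI: "g \<in> carrier H \<Longrightarrow> act g x0 \<in> Y"
  by (auto simp: orbit_def)

lemma orbit_nonempty: "Y \<noteq> {}"
  using orbit_memI[OF grp.one_closed] by blast

lemma act_orbit: "g \<in> carrier H \<Longrightarrow> y \<in> Y \<Longrightarrow> act g y \<in> Y"
  using act_mult x0_in by (auto simp: orbit_def) (metis grp.m_closed)

lemma dpt_equivariant:
  assumes "g \<in> carrier H" "U \<in> S" "x \<in> X" "y \<in> X"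
  shows "dpt (dact g U) (act g x) (act g y) = dpt U x y"
  unfolding dpt_def using assms
  by (simp add: proj_equivariant[symmetric] iso_isometry proj_in)

lemma near_equivariant:
  assumes "g \<in> carrier H" "U \<in> S" "V \<in> S" "x \<in> X" "V \<pitchfork> U \<or> V \<sqsubset> U"
  shows "near r (dact g U) (act g x) (rho (dact g V) (dact g U)) \<longleftrightarrow> near r U x (rho V U)"
proof -
  have "U \<pitchfork> V \<or> V \<sqsubset> U" using assms transverse_sym by blast
  then have eq: "rho (dact g V) (dact g U) = iso g U ` rho V U"
    using rho_equivariant assms by simp
  have "rho V U \<subseteq> C U" using assms rho_transverse rho_nested by blast
  then have "dC (dact g U) (proj (dact g U) (act g x)) (iso g U p) = dC U (proj U x) p"
    if "p \<in> rho V U" for p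
    using that assms iso_isometry[OF assms(1,2), of "proj U x" p] proj_in proj_equivariant by auto
  then show ?thesis unfolding near_def eq by auto
qed

lemma height_le_translate:
  assumes "g \<in> carrier H" "U \<in> S"
  shows "height U \<le> height (dact g U)"
proof -
  obtain K where K: "K \<subseteq> below U" "nest_chain K" "card K = height U" "finite K"
    by (rule height_chain)
  have KS: "K \<subseteq> S" using K(1) by (auto simp: below_def)
  have "inj_on (dact g) K"
    using dact_eq_iff[OF assms(1)] KS by (meson inj_onI subsetD)
  then have "height U = card (dact g ` K)" using K(3) card_image by metis
  also have "\<dots> \<le> height (dact g U)"
  proof (rule card_chain_le_height)
    show "dact g ` K \<subseteq> below (dact g U)"
    proof
      fix V' assume "V' \<in> dact g ` K"
      then obtain V where V: "V \<in> K" "V' = dact g V" by blast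
      then have "V \<in> S" "V \<sqsubseteq> U" using K(1) by (auto simp: below_def)
      then show "V' \<in> below (dact g U)"
        using V(2) dact_nest[OF assms(1) _ assms(2)] dact_in[OF assms(1)] by (simp add: below_def)
    qed
    have "dact g V \<sqsubseteq> dact g W \<or> dact g W \<sqsubseteq> dact g V" if VW: "V \<in> K" "W \<in> K" for V W
    proof -
      have "V \<in> S" "W \<in> S" using VW KS by auto
      then show ?thesis using dact_nest[OF assms(1)] K(2) VW by (auto simp: nest_chain_def)
    qed
    then show "nest_chain (dact g ` K)" by (simp add: nest_chain_def)
  qed
  finally show ?thesis .
qed

lemma height_equivariant: "g \<in> carrier H \<Longrightarrow> U \<in> S \<Longrightarrow> height (dact g U) = height U"
  using height_le_translate[of g U] height_le_translate[of "inv\<^bsub>H\<^esub> g" "dact g U"]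
  by (simp add: dact_inv dact_in)

lemma oscillates_translate:
  assumes "g \<in> carrier H" "U \<in> S" "oscillates Y U L"
  shows "oscillates Y (dact g U) L"
proof -
  obtain x y where "x \<in> Y" "y \<in> Y" "L < dpt U x y" using assms(3) by (auto simp: oscillates_def)
  moreover from this have "dpt (dact g U) (act g x) (act g y) = dpt U x y"
    using assms orbit_subset by (intro dpt_equivariant) auto
  ultimately show ?thesis using act_orbit[OF assms(1)] unfolding oscillates_def by metis
qed

lemma oscillates_equivariant:
  "g \<in> carrier H \<Longrightarrow> U \<in> S \<Longrightarrow> oscillates Y (dact g U) L \<longleftrightarrow> oscillates Y U L"
  using oscillates_translate[of g U L] oscillates_translate[of "inv\<^bsub>H\<^esub> g" "dact g U" L]
  by (auto simp: dact_inv dact_in)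

lemma unbounded_iff: "U \<in> unbounded \<longleftrightarrow> U \<in> S \<and> (\<forall>L. oscillates Y U L)"
proof (cases "U \<in> S")
  case True
  have sub: "proj U ` Y \<subseteq> C U" using proj_in[OF True] orbit_subset by blast
  have "Metric_space.mbounded (C U) (dC U) (proj U ` Y) \<longleftrightarrow>
      (\<exists>B. \<forall>x\<in>Y. \<forall>y\<in>Y. dpt U x y \<le> B)"
    using sub unfolding Metric_space.mbounded_alt[OF C_metric[OF True]] dpt_def by simp
  then show ?thesis using True unfolding unbounded_domains_def oscillates_def
    by (simp add: not_le)
qed (simp add: unbounded_domains_def)

lemma unbounded_in_S: "unbounded \<subseteq> S"
  using unbounded_iff by blast

lemma unbounded_equivariant: "g \<in> carrier H \<Longrightarrow> U \<in> S \<Longrightarrow> dact g U \<in> unbounded \<longleftrightarrow> U \<in> unbounded"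
  by (simp add: unbounded_iff oscillates_equivariant dact_in)

lemma dpt_orbit_step:
  assumes "W \<in> S" "g \<in> carrier H" "k \<in> carrier H"
  shows "dpt W (act g x0) (act (g \<otimes>\<^bsub>H\<^esub> k) x0) \<le> E * dX x0 (act k x0) + E"
proof -
  have "dpt W (act g x0) (act (g \<otimes>\<^bsub>H\<^esub> k) x0) \<le> E * dX (act g x0) (act (g \<otimes>\<^bsub>H\<^esub> k) x0) + E"
    using assms x0_in act_in by (intro proj_coarsely_lipschitz) auto
  then show ?thesis using assms x0_in act_in by (simp add: act_mult act_isometry)
qed


section \<open>Domains above transverse unbounded domains\<close>

text \<open>
  If \<open>u\<close> realises \<open>U\<close>, then \<open>x0\<close> is within bounded distance of \<open>u\<close>, hence \<open>act g x0\<close> is at bounded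
  distance from \<open>rho (dact g U) V\<close>, with a bound that depends on neither \<open>g\<close> nor \<open>V\<close>.
\<close>

lemma orbit_near_translates:
  assumes "U \<in> S"
  shows "\<exists>R. \<forall>g\<in>carrier H. \<forall>V\<in>S. dact g U \<sqsubset> V \<or> dact g U \<pitchfork> V \<longrightarrow>
    near R V (act g x0) (rho (dact g U) V)"
proof -
  obtain u where u: "u \<in> X"
    "\<And>V. V \<in> S \<Longrightarrow> U \<sqsubset> V \<or> U \<pitchfork> V \<Longrightarrow> dset V u (rho U V) \<le> ennreal E"
    using partial_realisation[of "{U}" "\<lambda>_. proj U x0"] assms proj_in x0_in by auto
  define R where "R = 2 * E + (E * dX x0 u + E)"
  have base: "near R V x0 (rho U V)" if V: "V \<in> S" "U \<sqsubset> V \<or> U \<pitchfork> V" for V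
  proof -
    have rho: "rho U V \<subseteq> C V \<and> set_diam (dC V) (rho U V) \<le> ennreal E"
      using V assms rho_nested rho_transverse by blast
    then have "near (2 * E) V u (rho U V)"
      using u V by (intro dset_le_near) auto
    moreover have "dC V (proj V x0) p \<le> dC V (proj V u) p + (E * dX x0 u + E)" if "p \<in> rho U V" for p
      using dC_proj_shift[OF V(1) x0_in u(1), of p] proj_coarsely_lipschitz[OF V(1) x0_in u(1)] rho that
      by force
    ultimately show ?thesis unfolding near_def R_def by force
  qed
  have "near R V (act g x0) (rho (dact g U) V)"
    if g: "g \<in> carrier H" and V: "V \<in> S" "dact g U \<sqsubset> V \<or> dact g U \<pitchfork> V" for g V
  proof -
    define V' where "V' = dact (inv\<^bsub>H\<^esub> g) V"
    have V': "V' \<in> S" "V = dact g V'" using g V dact_in dact_inv' by (auto simp: V'_def)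
    then have rel: "U \<sqsubset> V' \<or> U \<pitchfork> V'"
      using V(2) dact_pnest dact_transverse g assms by auto
    then show ?thesis
      using near_equivariant[OF g V'(1) assms x0_in] base[OF V'(1) rel] V'(2) by blast
  qed
  then show ?thesis by blast
qed

text \<open>
  A maximal pairwise orthogonal set of translates of \<open>U\<close> is finite, say \<open>{dact k U | k \<in> F}\<close>. By
  maximality every translate of \<open>U\<close> fails to be orthogonal to one of them, and so does every
  translate to one member of each translate of this set.
\<close>

lemma finite_nonorthogonal_translates:
  assumes "U \<in> S"
  shows "\<exists>F. finite F \<and> F \<subseteq> carrier H \<and>
    (\<forall>a\<in>carrier H. \<forall>g\<in>carrier H. \<exists>k\<in>F. \<not> dact (g \<otimes>\<^bsub>H\<^esub> k) U \<bottom> dact a U)"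
proof -
  let ?orb = "(\<lambda>k. dact k U) ` carrier H"
  let ?P = "\<lambda>\<O>. \<O> \<subseteq> ?orb \<and> pairwise (\<bottom>) \<O>"
  have sub: "?orb \<subseteq> S" using dact_in assms by blast
  obtain c where c: "\<And>\<O>. \<O> \<subseteq> S \<Longrightarrow> pairwise (\<bottom>) \<O> \<Longrightarrow> finite \<O> \<and> card \<O> \<le> c"
    using card_orthogonal_bounded by metis
  have "?P {}" by (simp add: pairwise_def)
  moreover have "\<forall>\<O>. ?P \<O> \<longrightarrow> card \<O> < Suc c" using c sub by (meson le_imp_less_Suc order_trans)
  ultimately have "\<exists>\<O>. ?P \<O> \<and> (\<forall>\<O>'. ?P \<O>' \<longrightarrow> card \<O>' \<le> card \<O>)"
    by (rule ex_has_greatest_nat)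
  then obtain \<O> where \<O>: "\<O> \<subseteq> ?orb" "pairwise (\<bottom>) \<O>" "\<And>\<O>'. ?P \<O>' \<Longrightarrow> card \<O>' \<le> card \<O>"
    by blast
  have "finite \<O>" using c \<O> sub by blast
  then obtain F where F: "F \<subseteq> carrier H" "finite F" "\<O> = (\<lambda>k. dact k U) ` F"
    using \<O>(1) by (meson finite_subset_image)
  have "\<exists>k\<in>F. \<not> dact (g \<otimes>\<^bsub>H\<^esub> k) U \<bottom> dact a U"
    if a: "a \<in> carrier H" and g: "g \<in> carrier H" for a g
  proof (rule ccontr)
    assume neg: "\<not> ?thesis"
    define Z where "Z = dact (inv\<^bsub>H\<^esub> g \<otimes>\<^bsub>H\<^esub> a) U"
    have ZS: "Z \<in> S" using a g assms dact_in by (simp add: Z_def)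
    have gZ: "dact g Z = dact a U"
      using a g assms dact_in dact_inv' by (simp add: Z_def dact_mult)
    have orth: "D \<bottom> Z" if D: "D \<in> \<O>" for D
    proof -
      obtain k where k: "k \<in> F" "D = dact k U" using D F(3) by blast
      moreover have "dact (g \<otimes>\<^bsub>H\<^esub> k) U = dact g D"
        using k F(1) g assms by (auto simp: dact_mult)
      ultimately have "dact g D \<bottom> dact g Z" using neg gZ by auto
      then show ?thesis using dact_orth[OF g _ ZS, of D] k F(1) assms dact_in by blast
    qed
    have "?P (insert Z \<O>)"
    proof
      have "Z \<in> ?orb" unfolding Z_def using a g by blast
      then show "insert Z \<O> \<subseteq> ?orb" using \<O>(1) by blast
      show "pairwise (\<bottom>) (insert Z \<O>)"
        using \<O>(1,2) orth orth_symD sub ZS unfolding pairwise_insert by blast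
    qed
    then have "card (insert Z \<O>) \<le> card \<O>" by (rule \<O>(3))
    moreover have "Z \<notin> \<O>" using orth orth_irreflD[OF ZS] by blast
    ultimately show False using \<open>finite \<O>\<close> by simp
  qed
  then show ?thesis using F by blast
qed

text \<open>
  Replacing \<open>g\<close> by a product with one of finitely many elements moves the projection of \<open>act g x0\<close>
  by at most \<open>K\<close> in every domain; this allows a far point to be chosen with a translate of \<open>U\<close> that
  is not orthogonal.
\<close>

lemma far_nonorthogonal_translate:
  assumes "U \<in> S"
  shows "\<exists>K. \<forall>a\<in>carrier H. \<forall>W\<in>S. \<forall>q\<in>C W. \<forall>L. oscillates Y W (2 * (L + K)) \<longrightarrow>
    (\<exists>h\<in>carrier H. L < dC W q (proj W (act h x0)) \<and> \<not> dact h U \<bottom> dact a U)"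
proof -
  obtain F where F: "finite F" "F \<subseteq> carrier H"
    "\<And>a g. a \<in> carrier H \<Longrightarrow> g \<in> carrier H \<Longrightarrow> \<exists>k\<in>F. \<not> dact (g \<otimes>\<^bsub>H\<^esub> k) U \<bottom> dact a U"
    using finite_nonorthogonal_translates[OF assms] by blast
  define K where "K = (\<Sum>k\<in>F. E * dX x0 (act k x0) + E)"
  have K: "E * dX x0 (act k x0) + E \<le> K" if "k \<in> F" for k
    unfolding K_def using F(1) that E_nonneg Metric_space.nonneg[OF X_metric]
    by (intro member_le_sum) auto
  have "\<exists>h\<in>carrier H. L < dC W q (proj W (act h x0)) \<and> \<not> dact h U \<bottom> dact a U"
    if a: "a \<in> carrier H" and W: "W \<in> S" and q: "q \<in> C W" and osc: "oscillates Y W (2 * (L + K))"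
    for a W q L
  proof -
    obtain g where g: "g \<in> carrier H" "L + K < dC W q (proj W (act g x0))"
      using oscillates_far_point[OF osc orbit_subset W q] by (auto simp: orbit_def)
    obtain k where k: "k \<in> F" "\<not> dact (g \<otimes>\<^bsub>H\<^esub> k) U \<bottom> dact a U" using F(3) a g(1) by blast
    let ?h = "g \<otimes>\<^bsub>H\<^esub> k"
    have kH: "k \<in> carrier H" using k F by blast
    then have h: "?h \<in> carrier H" using g by simp
    have "dC W (proj W (act g x0)) q \<le> dC W (proj W (act ?h x0)) q + dpt W (act g x0) (act ?h x0)"
      using W q g h x0_in act_in by (intro dC_proj_shift) auto
    also have "dpt W (act g x0) (act ?h x0) \<le> K"
      using dpt_orbit_step[OF W g(1) kH] K[OF k(1)] by simp
    finally have "L < dC W q (proj W (act ?h x0))"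
      using g(2) dC_commute[OF W, of q] by simp
    then show ?thesis using h k by blast
  qed
  then show ?thesis by blast
qed

text \<open>
  Pushing unboundedness up can go on only until the greatest height at which the diameters are not
  uniformly bounded; a contradiction arises when a chain lives at that height.
\<close>

lemma top_oscillating_height:
  assumes "\<Phi> \<subseteq> S" "\<And>L. \<exists>W\<in>\<Phi>. oscillates Y W L"
  obtains j B where "\<And>L. \<exists>W\<in>\<Phi>. height W = j \<and> oscillates Y W L"
    and "\<And>W. W \<in> \<Phi> \<Longrightarrow> j < height W \<Longrightarrow> \<not> oscillates Y W B"
proof -
  let ?P = "\<lambda>j. \<forall>L. \<exists>W\<in>\<Phi>. j \<le> height W \<and> oscillates Y W L"
  obtain n where n: "\<And>W. height W \<le> n" using height_bounded by blast
  have "?P 0" using assms(2) by simp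
  moreover have "\<forall>j. ?P j \<longrightarrow> j \<le> n" using n order_trans by blast
  ultimately have "\<exists>j. ?P j \<and> (\<forall>i. ?P i \<longrightarrow> i \<le> j)" by (rule Nat.ex_has_greatest_nat)
  then obtain j where j: "?P j" "\<not> ?P (Suc j)" by (metis Suc_n_not_le_n)
  then obtain B where B: "\<And>W. W \<in> \<Phi> \<Longrightarrow> j < height W \<Longrightarrow> \<not> oscillates Y W B"
    by (auto simp: Suc_le_eq)
  have "\<exists>W\<in>\<Phi>. height W = j \<and> oscillates Y W L" for L
  proof -
    obtain W where W: "W \<in> \<Phi>" "j \<le> height W" "oscillates Y W (max L B)" using j(1) by blast
    then have "oscillates Y W B" "oscillates Y W L" using oscillates_mono by (meson max.cobounded1 max.cobounded2)+
    then show ?thesis using W B[of W] by force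
  qed
  with B that show ?thesis by blast
qed


text \<open>
  Suppose that all domains above \<open>U\<close> have bounded orbit. Among the domains above translates of \<open>U\<close>,
  consider those of large diameter and of the greatest height at which the diameters are not uniformly
  bounded. They form long chains: at a far point \<open>act h x0\<close> of \<open>W\<close> the next domain is a domain \<open>V\<close> above \<open>dact h U\<close> with a
  larger diameter than \<open>W\<close>. Then \<open>V\<close> is not \<open>W\<close>, it is not comparable to \<open>W\<close> as the heights agree,
  and it is not orthogonal to \<open>W\<close> if \<open>dact h U\<close> is not orthogonal to the translate of \<open>U\<close> below \<open>W\<close>. The
  sets \<open>rho V W\<close> and \<open>rho (dact h U) W\<close> coarsely agree, and the latter is near \<open>act h x0\<close>.
\<close>

lemma unbounded_above:
  assumes U: "U \<in> S" and wild: "\<And>L. \<exists>W\<in>S. U \<sqsubset> W \<and> oscillates Y W L"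
  shows "\<exists>W\<in>unbounded. U \<sqsubset> W"
proof (rule ccontr)
  assume none: "\<not> ?thesis"
  define \<Phi> where "\<Phi> = {W \<in> S. \<exists>a\<in>carrier H. dact a U \<sqsubset> W}"
  have \<Phi>S: "\<Phi> \<subseteq> S" by (auto simp: \<Phi>_def)
  have bounded: "\<exists>L. \<not> oscillates Y W L" if W\<Phi>: "W \<in> \<Phi>" for W
  proof -
    obtain a where a: "a \<in> carrier H" "dact a U \<sqsubset> W" and W: "W \<in> S" using W\<Phi> unfolding \<Phi>_def by blast
    let ?W = "dact (inv\<^bsub>H\<^esub> a) W"
    have "U \<sqsubset> ?W"
      using dact_pnest[of "inv\<^bsub>H\<^esub> a" "dact a U" W] a W U by (simp add: dact_inv dact_in)
    then have "?W \<notin> unbounded" using none by blast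
    then show ?thesis using a(1) W by (simp add: unbounded_equivariant) (simp add: unbounded_iff)
  qed
  have "\<exists>W\<in>\<Phi>. oscillates Y W L" for L
    using wild[of L] dact_one[OF U] grp.one_closed unfolding \<Phi>_def by force
  then obtain j B where j: "\<And>L. \<exists>W\<in>\<Phi>. height W = j \<and> oscillates Y W L"
    and B: "\<And>W. W \<in> \<Phi> \<Longrightarrow> j < height W \<Longrightarrow> \<not> oscillates Y W B"
    using top_oscillating_height[OF \<Phi>S] by blast
  obtain R where R: "\<And>g V. g \<in> carrier H \<Longrightarrow> V \<in> S \<Longrightarrow> dact g U \<sqsubset> V \<or> dact g U \<pitchfork> V \<Longrightarrow>
      near R V (act g x0) (rho (dact g U) V)"
    using orbit_near_translates[OF U] by blast
  obtain K where K: "\<And>a W q L. a \<in> carrier H \<Longrightarrow> W \<in> S \<Longrightarrow> q \<in> C W \<Longrightarrow>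
      oscillates Y W (2 * (L + K)) \<Longrightarrow>
      \<exists>h\<in>carrier H. L < dC W q (proj W (act h x0)) \<and> \<not> dact h U \<bottom> dact a U"
    using far_nonorthogonal_translate[OF U] by blast
  (* The summand after 8 * E bounds the distance from act h x0 to rho V W. *)
  define L1 where "L1 = 8 * E + (\<bar>R\<bar> + 2 * E + 1)"
  define L0 where "L0 = 2 * (L1 + \<bar>K\<bar>)"
  define \<W> where "\<W> = {W \<in> \<Phi>. height W = j \<and> oscillates Y W L0}"
  have \<W>S: "\<W> \<subseteq> S" using \<Phi>S by (auto simp: \<W>_def)
  have L0: "2 * (8 * E) \<le> L0" "2 * (L1 + K) \<le> L0" using E_nonneg by (auto simp: L0_def L1_def)
  have "\<exists>W\<in>\<W>. \<exists>V\<in>S. W \<sqsubset> V \<and> oscillates Y V B"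
  proof (rule unbounded_above_chain[OF orbit_subset orbit_nonempty \<W>S])
    show "\<W> \<noteq> {}" using j[of L0] by (auto simp: \<W>_def)
  next
    fix W q assume "W \<in> \<W>" "q \<in> C W"
    then show "\<exists>y\<in>Y. 8 * E < dC W q (proj W y)"
      using oscillates_far_point[OF oscillates_mono[OF _ L0(1)] orbit_subset] \<W>S by (auto simp: \<W>_def)
  next
    fix W q assume W\<W>: "W \<in> \<W>" and q: "q \<in> C W"
    then have W: "W \<in> S" "height W = j" and oscW: "oscillates Y W (2 * (L1 + K))"
      using \<W>S oscillates_mono[OF _ L0(2)] by (auto simp: \<W>_def)
    obtain a where a: "a \<in> carrier H" "dact a U \<sqsubset> W" using W\<W> unfolding \<W>_def \<Phi>_def by blast
    obtain h where h: "h \<in> carrier H" "L1 < dC W q (proj W (act h x0))" "\<not> dact h U \<bottom> dact a U"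
      using K[OF a(1) W(1) q oscW] by blast
    have aU: "dact a U \<in> S" and hU: "dact h U \<in> S" using a h U dact_in by auto
    (* Larger oscillation than that of W makes the next domain differ from W. *)
    obtain LW where LW: "\<not> oscillates Y W LW" using bounded W\<W> by (auto simp: \<W>_def)
    obtain W' where W': "W' \<in> \<Phi>" "height W' = j" "oscillates Y W' (max L0 LW)" using j by blast
    then obtain a' where a': "a' \<in> carrier H" "dact a' U \<sqsubset> W'" and W'S: "W' \<in> S"
      unfolding \<Phi>_def by blast
    define t where "t = h \<otimes>\<^bsub>H\<^esub> inv\<^bsub>H\<^esub> a'"
    define V where "V = dact t W'"
    have t: "t \<in> carrier H" using h a' by (simp add: t_def)
    have V: "V \<in> S" "height V = j" using t W' W'S by (auto simp: V_def dact_in height_equivariant)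
    have tU: "dact t (dact a' U) = dact h U"
      using h a' U by (simp add: t_def dact_mult dact_in dact_inv)
    have hUV: "dact h U \<sqsubset> V"
      using dact_pnest[OF t dact_in[OF a'(1) U] W'S] a'(2) by (simp add: tU V_def)
    have oscV: "oscillates Y V (max L0 LW)"
      using W'(3) t W'S by (simp add: V_def oscillates_equivariant)
    have V\<W>: "V \<in> \<W>"
      using V hUV h oscillates_mono[OF oscV] by (auto simp: \<W>_def \<Phi>_def)
    have "V \<noteq> W" using LW oscillates_mono[OF oscV, of LW] by auto
    moreover have "\<not> V \<bottom> W"
      using orth_nest2[OF hU aU V(1) W(1)] h(3) hUV a(2) by (auto simp: pnest_def)
    ultimately have VW: "V \<pitchfork> W" using V W by (intro transverse_if_same_height) auto
    have "\<not> dact h U \<bottom> W"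
      using orth_nest2[OF hU aU hU W(1)] h(3) a(2) nest_reflD[OF hU] by (auto simp: pnest_def)
    then have nWh: "\<not> W \<bottom> dact h U" and nhW: "\<not> dact h U \<bottom> W"
      using orth_symD hU W(1) by auto
    have "\<not> W \<sqsubseteq> dact h U"
      using VW nest_transD[OF W(1) hU V(1)] hUV by (auto simp: transverse_def pnest_def)
    then have rel: "dact h U \<sqsubset> W \<or> dact h U \<pitchfork> W"
      using nhW nest_reflD[OF W(1)] by (auto simp: pnest_def transverse_def)
    then have nearhU: "near R W (act h x0) (rho (dact h U) W)" using R h(1) W(1) by blast
    have rhU: "rho (dact h U) W \<subseteq> C W" using rel rho_nested rho_transverse hU W(1) by blast
    have rV: "rho V W \<subseteq> C W" "set_diam (dC W) (rho V W) \<le> ennreal E"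
      using rho_transverse V W VW by blast+
    have "set_dist (dC W) (rho (dact h U) W) (rho V W) \<le> ennreal E"
      using consistency_rho[OF hU V(1) W(1)] hUV VW nWh by (auto simp: pnest_def)
    then obtain p1 p2 where p12: "p1 \<in> rho (dact h U) W" "p2 \<in> rho V W" "dC W p1 p2 < E + 1"
      using set_dist_leD[OF _ E_nonneg, of _ _ _ 1] by fastforce
    have "8 * E < dC W q p" if p: "p \<in> rho V W" for p
    proof -
      have y: "proj W (act h x0) \<in> C W" using proj_in W(1) act_in h(1) x0_in by blast
      have C: "p1 \<in> C W" "p2 \<in> C W" "p \<in> C W" using p12 p rhU rV by auto
      have "dC W (proj W (act h x0)) p1 \<le> R" using nearhU p12(1) nearD by blast
      moreover have "dC W p2 p \<le> E" using set_diam_leD[OF rV(2) E_nonneg p12(2) p] .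
      moreover have "dC W (proj W (act h x0)) p \<le> dC W (proj W (act h x0)) p1 + dC W p1 p"
        "dC W p1 p \<le> dC W p1 p2 + dC W p2 p"
        "dC W q (proj W (act h x0)) \<le> dC W q p + dC W p (proj W (act h x0))"
        using W(1) C y q by (auto intro: dC_triangle)
      ultimately show ?thesis
        using h(2) p12(3) dC_commute[OF W(1), of p "proj W (act h x0)"] by (simp add: L1_def)
    qed
    then show "\<exists>V\<in>\<W>. V \<pitchfork> W \<and> (\<forall>p\<in>rho V W. 8 * E < dC W q p)" using V\<W> VW by blast
  qed
  then obtain W V where W: "W \<in> \<W>" and V: "V \<in> S" "W \<sqsubset> V" "oscillates Y V B" by blast
  then obtain a where a: "a \<in> carrier H" "dact a U \<sqsubset> W" "W \<in> S" "height W = j"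
    unfolding \<W>_def \<Phi>_def by blast
  have "dact a U \<sqsubset> V"
    using a V nest_transD[of "dact a U" W V] nest_antisymD[of W V] dact_in[OF a(1) U]
    by (auto simp: pnest_def)
  then have "V \<in> \<Phi>" using a(1) V(1) by (auto simp: \<Phi>_def)
  moreover have "j < height V" using height_strict_mono a V by blast
  ultimately show False using B V(3) by blast
qed

text \<open>
  Translates of \<open>U\<close> have the same height, so one that is not orthogonal to \<open>U\<close> is transverse to \<open>U\<close> or
  equal to it; in the latter case the same group element moves \<open>V\<close> to a domain transverse to \<open>U\<close>.
  So chains of translates of \<open>U\<close> and \<open>V\<close> can be continued at far points, and \<open>unbounded_above\<close>
  contradicts the maximality of \<open>U\<close> or of \<open>V\<close>.
\<close>

lemma maximal_unbounded_not_transverse: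
  assumes U: "U \<in> unbounded" "\<And>W. W \<in> unbounded \<Longrightarrow> \<not> U \<sqsubset> W"
    and V: "V \<in> unbounded" "\<And>W. W \<in> unbounded \<Longrightarrow> \<not> V \<sqsubset> W"
  shows "\<not> U \<pitchfork> V"
proof
  assume UV: "U \<pitchfork> V"
  have US: "U \<in> S" and VS: "V \<in> S" using U V unbounded_in_S by auto
  have VU: "V \<pitchfork> U" using transverse_sym US VS UV by blast
  have bounded: "\<exists>L. \<forall>W\<in>S. Z \<sqsubset> W \<longrightarrow> \<not> oscillates Y W L" if "Z \<in> {U, V}" for Z
    using unbounded_above[of Z] U(2) V(2) US VS that by blast
  obtain M1 M2 where M1: "\<And>W. W \<in> S \<Longrightarrow> U \<sqsubset> W \<Longrightarrow> \<not> oscillates Y W M1"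
    and M2: "\<And>W. W \<in> S \<Longrightarrow> V \<sqsubset> W \<Longrightarrow> \<not> oscillates Y W M2"
    using bounded[of U] bounded[of V] by blast
  define M where "M = max M1 M2"
  define \<W> where "\<W> = {dact a Z | a Z. a \<in> carrier H \<and> Z \<in> {U, V}}"
  have \<W>S: "\<W> \<subseteq> S" using US VS dact_in by (auto simp: \<W>_def)
  have "\<exists>W\<in>\<W>. \<exists>W'\<in>S. W \<sqsubset> W' \<and> oscillates Y W' M"
  proof (rule unbounded_above_chain[OF orbit_subset orbit_nonempty \<W>S])
    show "\<W> \<noteq> {}" using grp.one_closed by (auto simp: \<W>_def)
  next
    fix W q assume "W \<in> \<W>" "q \<in> C W"
    moreover from this have "W \<in> unbounded"
      using U(1) V(1) US VS unbounded_equivariant by (auto simp: \<W>_def)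
    ultimately show "\<exists>y\<in>Y. 8 * E < dC W q (proj W y)"
      using oscillates_far_point[OF _ orbit_subset] \<W>S unbounded_iff by blast
  next
    have step: "\<exists>D\<in>\<W>. D \<pitchfork> dact a Z \<and> (\<forall>p\<in>rho D (dact a Z). 8 * E < dC (dact a Z) q p)"
      if a: "a \<in> carrier H" and q: "q \<in> C (dact a Z)" and ZZ': "Z \<in> {U, V}" "Z' \<in> {U, V}" "Z' \<pitchfork> Z"
      for a Z Z' q
    proof -
      let ?W = "dact a Z"
      have ZS: "Z \<in> S" and Z'S: "Z' \<in> S" and WS: "?W \<in> S" using ZZ' US VS a dact_in by auto
      have Zunb: "Z \<in> unbounded" using ZZ' U(1) V(1) by auto
      obtain R where R: "\<And>g D. g \<in> carrier H \<Longrightarrow> D \<in> S \<Longrightarrow> dact g Z \<pitchfork> D \<Longrightarrow>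
          near R D (act g x0) (rho (dact g Z) D)"
        using orbit_near_translates[OF ZS] by blast
      obtain R' where R': "\<And>g D. g \<in> carrier H \<Longrightarrow> D \<in> S \<Longrightarrow> dact g Z' \<pitchfork> D \<Longrightarrow>
          near R' D (act g x0) (rho (dact g Z') D)"
        using orbit_near_translates[OF Z'S] by blast
      define r where "r = max R R'"
      have "oscillates Y ?W L" for L
        using Zunb a ZS by (simp add: oscillates_equivariant unbounded_iff)
      then obtain h where h: "h \<in> carrier H" "8 * E + r < dC ?W q (proj ?W (act h x0))"
        "\<not> dact h Z \<bottom> ?W"
        using far_nonorthogonal_translate[OF ZS] a WS q by meson
      have "\<exists>D\<in>\<W>. D \<pitchfork> ?W \<and> near r ?W (act h x0) (rho D ?W)"
      proof (cases "dact h Z = ?W")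
        case True
        have "dact h Z' \<pitchfork> ?W"
          using dact_transverse[OF h(1) Z'S ZS] ZZ'(3) True by simp
        moreover have "dact h Z' \<in> \<W>" using h(1) ZZ'(2) unfolding \<W>_def by blast
        moreover have "near r ?W (act h x0) (rho (dact h Z') ?W)"
          using R'[OF h(1) WS] \<open>dact h Z' \<pitchfork> ?W\<close> unfolding near_def r_def by force
        ultimately show ?thesis by blast
      next
        case False
        have "height (dact h Z) = height ?W" using h a ZS by (simp add: height_equivariant)
        then have "dact h Z \<pitchfork> ?W"
          using False h dact_in[OF h(1) ZS] WS by (intro transverse_if_same_height)
        moreover have "dact h Z \<in> \<W>" using h(1) ZZ'(1) unfolding \<W>_def by blast
        moreover have "near r ?W (act h x0) (rho (dact h Z) ?W)"
          using R[OF h(1) WS] \<open>dact h Z \<pitchfork> ?W\<close> unfolding near_def r_def by force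
        ultimately show ?thesis by blast
      qed
      then obtain D where D: "D \<in> \<W>" "D \<pitchfork> ?W" "near r ?W (act h x0) (rho D ?W)" by blast
      have "8 * E < dC ?W q p" if p: "p \<in> rho D ?W" for p
      proof -
        have "p \<in> C ?W" using p rho_transverse[OF _ WS D(2)] D(1) \<W>S by blast
        moreover have "proj ?W (act h x0) \<in> C ?W" using proj_in WS act_in h(1) x0_in by blast
        ultimately have "dC ?W q (proj ?W (act h x0)) \<le> dC ?W q p + dC ?W p (proj ?W (act h x0))"
          using WS q by (intro dC_triangle)
        then show ?thesis
          using h(2) nearD[OF D(3) p] dC_commute[OF WS, of p] by simp
      qed
      then show ?thesis using D by blast
    qed
    fix W q assume W: "W \<in> \<W>" "q \<in> C W"
    then obtain a Z where a: "a \<in> carrier H" "Z \<in> {U, V}" "W = dact a Z" unfolding \<W>_def by blast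
    show "\<exists>D\<in>\<W>. D \<pitchfork> W \<and> (\<forall>p\<in>rho D W. 8 * E < dC W q p)"
      using step[of a q U V] step[of a q V U] a W(2) UV VU by blast
  qed
  then obtain a Z W' where a: "a \<in> carrier H" and Z: "Z \<in> {U, V}"
    and W': "W' \<in> S" "dact a Z \<sqsubset> W'" "oscillates Y W' M"
    unfolding \<W>_def by blast
  let ?W = "dact (inv\<^bsub>H\<^esub> a) W'"
  have "Z \<in> S" using Z US VS by auto
  then have "Z \<sqsubset> ?W"
    using dact_pnest[of "inv\<^bsub>H\<^esub> a" "dact a Z" W'] a W' by (simp add: dact_inv dact_in)
  moreover have "oscillates Y ?W M" "?W \<in> S" using W' a by (auto simp: oscillates_equivariant dact_in)
  ultimately show False
    using Z M1[of ?W] M2[of ?W] oscillates_mono[of Y ?W M] by (auto simp: M_def)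
qed

end
section \<open>Finitely generated groups\<close>

context group
begin

primrec word_ball :: "'a set \<Rightarrow> nat \<Rightarrow> 'a set" where
  "word_ball T 0 = {\<one>}"
| "word_ball T (Suc n) = (\<Union>s\<in>T. \<Union>b\<in>word_ball T n. {s \<otimes> b})"

lemma word_ball_subset: "T \<subseteq> carrier G \<Longrightarrow> word_ball T n \<subseteq> carrier G"
  by (induction n) auto

lemma finite_word_ball: "finite T \<Longrightarrow> finite (word_ball T n)"
  by (induction n) auto

lemma word_ball_Suc_mono:
  assumes "T \<subseteq> carrier G" "\<one> \<in> T"
  shows "word_ball T n \<subseteq> word_ball T (Suc n)"
proof
  fix b assume b: "b \<in> word_ball T n"
  have "b \<in> carrier G" using b word_ball_subset[OF assms(1)] by blast
  then have "b = \<one> \<otimes> b" by simp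
  then show "b \<in> word_ball T (Suc n)" using b assms(2) by auto
qed

lemma word_ball_mono:
  "T \<subseteq> carrier G \<Longrightarrow> \<one> \<in> T \<Longrightarrow> m \<le> n \<Longrightarrow> word_ball T m \<subseteq> word_ball T n"
  using lift_Suc_mono_le[of "word_ball T" m n] word_ball_Suc_mono by blast

lemma word_ball_mult:
  assumes "T \<subseteq> carrier G" "x \<in> word_ball T m" "y \<in> word_ball T n"
  shows "x \<otimes> y \<in> word_ball T (m + n)"
  using assms(2)
proof (induction m arbitrary: x)
  case 0
  moreover have "y \<in> carrier G" using assms(1,3) word_ball_subset by blast
  ultimately show ?case using assms(3) by simp
next
  case (Suc m)
  then obtain s b where sb: "s \<in> T" "b \<in> word_ball T m" "x = s \<otimes> b" by auto
  have "s \<in> carrier G" "b \<in> carrier G" "y \<in> carrier G"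
    using sb assms word_ball_subset by blast+
  then have "x \<otimes> y = s \<otimes> (b \<otimes> y)" using sb(3) by (simp add: m_assoc)
  then show ?case using sb(1) Suc.IH[OF sb(2)] by auto
qed

lemma word_ball_generator:
  assumes "T \<subseteq> carrier G" "s \<in> T"
  shows "s \<in> word_ball T 1"
proof -
  have "s = s \<otimes> \<one>" using assms by auto
  then show ?thesis using assms(2) by auto
qed

lemma word_ball_inv:
  assumes "T \<subseteq> carrier G" "\<And>s. s \<in> T \<Longrightarrow> inv s \<in> T" "x \<in> word_ball T n"
  shows "inv x \<in> word_ball T n"
  using assms(3)
proof (induction n arbitrary: x)
  case (Suc n)
  then obtain s b where sb: "s \<in> T" "b \<in> word_ball T n" "x = s \<otimes> b" by auto
  have "s \<in> carrier G" "b \<in> carrier G" using sb assms word_ball_subset by blast+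
  then have "inv x = inv b \<otimes> inv s" using sb(3) by (simp add: inv_mult_group)
  then show ?case
    using word_ball_mult[OF assms(1) Suc.IH[OF sb(2)], of "inv s" 1]
      word_ball_generator[OF assms(1) assms(2)[OF sb(1)]] by simp
qed simp

end

text \<open>As long as the sets grow, so do their cardinalities.\<close>

lemma increasing_sets_stabilise:
  fixes \<O> :: "nat \<Rightarrow> 'z set"
  assumes "\<And>i. \<O> i \<subseteq> \<O> (Suc i)" "\<And>i. finite (\<O> i)" "card (\<O> (Suc n)) \<le> n"
  shows "\<exists>i\<le>n. \<O> (Suc i) = \<O> i"
proof (rule ccontr)
  assume "\<not> ?thesis"
  then have strict: "\<O> i \<subset> \<O> (Suc i)" if "i \<le> n" for i using assms(1)[of i] that by blast
  have "i \<le> Suc n \<Longrightarrow> i \<le> card (\<O> i)" for i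
  proof (induction i)
    case (Suc i)
    then have "card (\<O> i) < card (\<O> (Suc i))" using strict[of i] assms(2) psubset_card_mono by auto
    then show ?case using Suc by simp
  qed simp
  from this[of "Suc n"] show False using assms(3) by simp
qed

text \<open>
  Finite generation of the image of \<open>H\<close> in the symmetric group of \<open>X\<close> does not make \<open>H\<close> finitely
  generated, and the kernel of the action on \<open>X\<close> can move domains. Hence the symmetric set \<open>T\<close> is only
  assumed to generate a subgroup with the same orbit of \<open>x0\<close>.
\<close>

locale generated_hhs_action = pointed_hhs_action +
  fixes T
  assumes T: "finite T" "T \<subseteq> carrier H" "\<one>\<^bsub>H\<^esub> \<in> T" "\<And>s. s \<in> T \<Longrightarrow> inv\<^bsub>H\<^esub> s \<in> T"
    and orbit_words: "\<And>y. y \<in> orbit H act x0 \<Longrightarrow> \<exists>n. \<exists>g\<in>group.word_ball H T n. y = act g x0"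
begin

abbreviation wball where "wball \<equiv> grp.word_ball T"

lemma wball_in: "b \<in> wball n \<Longrightarrow> b \<in> carrier H"
  using grp.word_ball_subset[OF T(2)] by blast

lemma wball_le: "b \<in> wball m \<Longrightarrow> m \<le> n \<Longrightarrow> b \<in> wball n"
  using grp.word_ball_mono[OF T(2,3)] by blast

lemmas wball_mult = grp.word_ball_mult[OF T(2)]
lemma wball_inv: "b \<in> wball n \<Longrightarrow> inv\<^bsub>H\<^esub> b \<in> wball n"
  using grp.word_ball_inv[OF T(2)] T(4) by blast


text \<open>
  In a slow domain with large diameter the orbit spreads only by long words. A rotation of a large
  hyperbolic disc by a tiny angle behaves like this, so slow domains have to be ruled out by their
  position relative to other domains and not by their geometry alone.
\<close>

definition slow where
  "slow r W \<longleftrightarrow> (\<forall>g\<in>carrier H. \<forall>b\<in>wball r. dpt (dact g W) x0 (act b x0) < E)"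

text \<open>Short words move a tame domain only to places where it cannot interact with itself.\<close>

definition tame where
  "tame r W \<longleftrightarrow> (\<forall>b\<in>wball r. dact b W = W \<or> dact b W \<bottom> W)"

lemma slowD: "slow r W \<Longrightarrow> W \<in> S \<Longrightarrow> b \<in> wball r \<Longrightarrow> dpt W x0 (act b x0) < E"
  unfolding slow_def using grp.one_closed dact_one by metis

text \<open>
  If \<open>x0\<close> is far from \<open>rho (dact b W) W\<close> in \<open>W\<close>, then it is near \<open>rho W (dact b W)\<close> in \<open>dact b W\<close>.
  So is then \<open>act b x0\<close> when \<open>dact b W\<close> hardly sees the step, and applying \<open>inv b\<close> shows that \<open>x0\<close>
  is near \<open>rho (dact (inv b) W) W\<close>.
\<close>

lemma near_neighbour:
  assumes W: "W \<in> S" and b: "b \<in> carrier H" and tr: "dact b W \<pitchfork> W"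
    and step: "dpt (dact b W) x0 (act b x0) \<le> E"
  shows "\<exists>b'\<in>carrier H. dact b' W \<pitchfork> W \<and> near (3 * E) W x0 (rho (dact b' W) W)"
proof -
  have bW: "dact b W \<in> S" using dact_in b W by blast
  let ?c = "inv\<^bsub>H\<^esub> b"
  have c: "?c \<in> carrier H" and cW: "dact ?c W \<in> S" using b W dact_in by auto
  consider "near (2 * E) W x0 (rho (dact b W) W)" | "near (2 * E) (dact b W) x0 (rho W (dact b W))"
    using transverse_near[OF bW W tr x0_in] by blast
  then show ?thesis
  proof cases
    case 1
    then have "near (3 * E) W x0 (rho (dact b W) W)" unfolding near_def using E_nonneg by force
    then show ?thesis using b tr by blast
  next
    case 2
    have Wb: "W \<pitchfork> dact b W" using transverse_sym bW W tr by blast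
    have bx: "act b x0 \<in> X" using act_in b x0_in by blast
    have "near (3 * E) (dact b W) (act b x0) (rho W (dact b W))"
      unfolding near_def
    proof
      fix p assume p: "p \<in> rho W (dact b W)"
      then have "p \<in> C (dact b W)" using rho_transverse[OF W bW Wb] by blast
      then have "dC (dact b W) (proj (dact b W) (act b x0)) p \<le>
          dC (dact b W) (proj (dact b W) x0) p + dpt (dact b W) (act b x0) x0"
        using bW bx x0_in by (intro dC_proj_shift)
      then show "dC (dact b W) (proj (dact b W) (act b x0)) p \<le> 3 * E"
        using nearD[OF 2 p] step dpt_commute[OF bW, of x0] by simp
    qed
    moreover have cWW: "dact ?c W \<pitchfork> W"
      using dact_transverse[OF c W bW] Wb dact_inv[OF b W] by simp
    ultimately have "near (3 * E) W x0 (rho (dact ?c W) W)"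
      using near_equivariant[OF b W cW x0_in] dact_inv'[OF b W] by simp
    then show ?thesis using c cWW by blast
  qed
qed

text \<open>
  A slow domain none of whose translates is tame gives long chains: next to each far point
  \<open>act h x0\<close> in a translate \<open>V\<close> there is \<open>rho D V\<close> for a neighbour \<open>D\<close> of \<open>V\<close>, again a translate. Here
  \<open>11 * E\<close> is the \<open>8 * E\<close> of chains and the \<open>3 * E\<close> of \<open>near_neighbour\<close>.
\<close>

lemma slow_tame_translate:
  assumes W: "W \<in> S" and slow: "slow r W" and osc: "oscillates Y W (2 * (11 * E))"
    and above: "\<And>V. V \<in> S \<Longrightarrow> height W < height V \<Longrightarrow> \<not> oscillates Y V M"
  shows "\<exists>g\<in>carrier H. tame r (dact g W)"
proof (rule ccontr)
  assume none: "\<not> ?thesis"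
  define \<W> where "\<W> = (\<lambda>g. dact g W) ` carrier H"
  have \<W>S: "\<W> \<subseteq> S" using dact_in W by (auto simp: \<W>_def)
  have translate: "dact g V \<in> \<W>" if gV: "g \<in> carrier H" "V \<in> \<W>" for g V
  proof -
    obtain a where "a \<in> carrier H" "V = dact a W" using gV(2) by (auto simp: \<W>_def)
    then have "dact g V = dact (g \<otimes>\<^bsub>H\<^esub> a) W" "g \<otimes>\<^bsub>H\<^esub> a \<in> carrier H"
      using gV(1) W by (simp_all add: dact_mult)
    then show ?thesis by (auto simp: \<W>_def)
  qed
  have height: "height V = height W" if "V \<in> \<W>" for V
    using that W by (auto simp: \<W>_def height_equivariant)
  have far: "\<exists>g\<in>carrier H. 11 * E < dC V q (proj V (act g x0))" if V: "V \<in> \<W>" "q \<in> C V" for V q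
  proof -
    have "oscillates Y V (2 * (11 * E))"
      using V(1) osc W by (auto simp: \<W>_def oscillates_equivariant)
    then show ?thesis using oscillates_far_point[OF _ orbit_subset] V \<W>S by (force simp: orbit_def)
  qed
  have "\<exists>D\<in>\<W>. \<exists>V\<in>S. D \<sqsubset> V \<and> oscillates Y V M"
  proof (rule unbounded_above_chain[OF orbit_subset orbit_nonempty \<W>S])
    show "\<W> \<noteq> {}" using grp.one_closed by (auto simp: \<W>_def)
  next
    fix V q assume "V \<in> \<W>" "q \<in> C V"
    then obtain g where "g \<in> carrier H" "11 * E < dC V q (proj V (act g x0))" using far by blast
    then show "\<exists>y\<in>Y. 8 * E < dC V q (proj V y)" using E_nonneg orbit_memI by force
  next
    fix V q assume V: "V \<in> \<W>" "q \<in> C V"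
    then have VS: "V \<in> S" using \<W>S by blast
    obtain h where h: "h \<in> carrier H" "11 * E < dC V q (proj V (act h x0))" using far V by blast
    (* Translating by inv h moves the far point to x0, where short words act. *)
    define Z where "Z = dact (inv\<^bsub>H\<^esub> h) V"
    have Z: "Z \<in> \<W>" "Z \<in> S" using translate[of "inv\<^bsub>H\<^esub> h" V] h V \<W>S by (auto simp: Z_def)
    have hZ: "dact h Z = V" using dact_inv'[OF h(1) VS] by (simp add: Z_def)
    have "\<not> tame r Z" using none Z(1) by (auto simp: \<W>_def)
    then obtain b where b: "b \<in> wball r" "dact b Z \<noteq> Z" "\<not> dact b Z \<bottom> Z" by (auto simp: tame_def)
    have bH: "b \<in> carrier H" using wball_in b(1) by blast
    have bZ: "dact b Z \<in> \<W>" using translate bH Z(1) by blast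
    have "height (dact b Z) = height Z" using height[OF bZ] height[OF Z(1)] by simp
    then have "dact b Z \<pitchfork> Z" using b(2,3) Z(2) bZ \<W>S by (intro transverse_if_same_height) auto
    moreover have "dpt (dact b Z) x0 (act b x0) \<le> E"
      using bZ slow b(1) unfolding slow_def \<W>_def by (auto intro: less_imp_le)
    ultimately obtain b' where b': "b' \<in> carrier H" "dact b' Z \<pitchfork> Z"
      "near (3 * E) Z x0 (rho (dact b' Z) Z)"
      using near_neighbour[OF Z(2) bH] by blast
    define D where "D = dact h (dact b' Z)"
    have b'Z: "dact b' Z \<in> \<W>" using translate b' Z by blast
    then have b'ZS: "dact b' Z \<in> S" using \<W>S by blast
    have D: "D \<in> \<W>" using translate[OF h(1) b'Z] by (simp add: D_def)
    have DV: "D \<pitchfork> V" using dact_transverse[OF h(1) b'ZS Z(2)] b'(2) by (simp add: D_def hZ)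
    have nearD': "near (3 * E) V (act h x0) (rho D V)"
      using near_equivariant[OF h(1) Z(2) b'ZS x0_in] b'(2,3) by (simp add: D_def hZ)
    have "8 * E < dC V q p" if p: "p \<in> rho D V" for p
    proof -
      have "p \<in> C V" using p rho_transverse[OF _ VS DV] D \<W>S by blast
      moreover have "proj V (act h x0) \<in> C V" using proj_in VS act_in h(1) x0_in by blast
      ultimately have "dC V q (proj V (act h x0)) \<le> dC V q p + dC V p (proj V (act h x0))"
        using VS V(2) by (intro dC_triangle)
      then show ?thesis using h(2) nearD[OF nearD' p] dC_commute[OF VS, of p] by simp
    qed
    then show "\<exists>D\<in>\<W>. D \<pitchfork> V \<and> (\<forall>p\<in>rho D V. 8 * E < dC V q p)" using D DV by blast
  qed
  then obtain D V where D: "D \<in> \<W>" "V \<in> S" "D \<sqsubset> V" "oscillates Y V M" by blast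
  then have "height W < height V" using height_strict_mono[of D V] height[of D] \<W>S by auto
  then show False using above D by blast
qed

text \<open>
  The translates of a tame domain by short words are pairwise orthogonal, so there are at most \<open>c\<close> of
  them, and at most \<open>c * c\<close> pairs of translates of two tame domains; the orbit of the pair is
  exhausted as soon as one more letter brings no new pair, which happens within \<open>c * c\<close> letters. Two
  words of length \<open>Suc (c * c)\<close> differ by one of twice that length; this is the choice of \<open>r\<close>.
\<close>

lemma tame_pair_orbit:
  assumes c: "\<And>\<W>. \<W> \<subseteq> S \<Longrightarrow> pairwise (\<bottom>) \<W> \<Longrightarrow> finite \<W> \<and> card \<W> \<le> c"
    and r: "r = 2 * Suc (c * c)"
    and W: "W \<in> S" "tame r W" and V: "V \<in> S" "tame r V"
  shows "\<forall>m. \<forall>g\<in>wball m. \<exists>b\<in>wball r. dact g W = dact b W \<and> dact g V = dact b V"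
proof -
  let ?n = "c * c"
  define \<O> where "\<O> i = (\<lambda>b. (dact b W, dact b V)) ` wball i" for i
  have small: "card ((\<lambda>b. dact b Z) ` wball (Suc ?n)) \<le> c" if Z: "Z \<in> S" "tame r Z" for Z
  proof -
    have "pairwise (\<bottom>) ((\<lambda>b. dact b Z) ` wball (Suc ?n))"
    proof (rule pairwiseI)
      fix D D' assume "D \<in> (\<lambda>b. dact b Z) ` wball (Suc ?n)" "D' \<in> (\<lambda>b. dact b Z) ` wball (Suc ?n)"
        and ne: "D \<noteq> D'"
      then obtain b b' where b: "b \<in> wball (Suc ?n)" "D = dact b Z"
        and b': "b' \<in> wball (Suc ?n)" "D' = dact b' Z" by blast
      have H: "b \<in> carrier H" "b' \<in> carrier H" using wball_in b b' by blast+
      let ?a = "inv\<^bsub>H\<^esub> b' \<otimes>\<^bsub>H\<^esub> b"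
      have "?a \<in> wball (Suc ?n + Suc ?n)" using wball_mult wball_inv b b' by blast
      then have a: "?a \<in> wball r" by (simp add: r mult_2)
      have aH: "?a \<in> carrier H" using H by simp
      have D: "D = dact b' (dact ?a Z)"
        using H Z(1) b(2) by (simp add: dact_mult dact_in dact_inv')
      then have "dact ?a Z \<noteq> Z" using ne b'(2) by auto
      then have "dact ?a Z \<bottom> Z" using Z(2) a by (auto simp: tame_def)
      then show "D \<bottom> D'" using dact_orth[OF H(2) dact_in[OF aH Z(1)] Z(1)] D b'(2) by simp
    qed
    moreover have "(\<lambda>b. dact b Z) ` wball (Suc ?n) \<subseteq> S" using wball_in dact_in Z(1) by blast
    ultimately show ?thesis using c by blast
  qed
  have fin: "finite (wball i)" for i using grp.finite_word_ball T(1) by blast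
  have "\<O> (Suc ?n) \<subseteq> (\<lambda>b. dact b W) ` wball (Suc ?n) \<times> (\<lambda>b. dact b V) ` wball (Suc ?n)"
    unfolding \<O>_def by blast
  then have "card (\<O> (Suc ?n)) \<le>
      card ((\<lambda>b. dact b W) ` wball (Suc ?n) \<times> (\<lambda>b. dact b V) ` wball (Suc ?n))"
    using fin by (intro card_mono) blast+
  also have "\<dots> \<le> ?n"
    using small[OF W] small[OF V] by (simp only: card_cartesian_product mult_le_mono)
  finally have "card (\<O> (Suc ?n)) \<le> ?n" .
  moreover have mono: "\<O> i \<subseteq> \<O> (Suc i)" for i
    unfolding \<O>_def using grp.word_ball_Suc_mono[OF T(2,3)] by blast
  moreover have "finite (\<O> i)" for i unfolding \<O>_def using fin by blast
  ultimately obtain i where i: "i \<le> ?n" "\<O> (Suc i) = \<O> i"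
    using increasing_sets_stabilise[of \<O> ?n] by blast
  have sub: "\<O> m \<subseteq> \<O> i" for m
  proof (induction m)
    case 0
    show ?case by (rule lift_Suc_mono_le[of \<O>, OF mono]) simp
  next
    case (Suc m)
    show ?case
    proof
      fix P assume "P \<in> \<O> (Suc m)"
      then obtain s b where sb: "s \<in> T" "b \<in> wball m" "P = (dact (s \<otimes>\<^bsub>H\<^esub> b) W, dact (s \<otimes>\<^bsub>H\<^esub> b) V)"
        unfolding \<O>_def by auto
      then have "(dact b W, dact b V) \<in> \<O> i" using Suc unfolding \<O>_def by blast
      then obtain b' where b': "b' \<in> wball i" "dact b W = dact b' W" "dact b V = dact b' V"
        unfolding \<O>_def by blast
      have "s \<in> carrier H" "b \<in> carrier H" "b' \<in> carrier H" using sb b' T wball_in by blast+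
      then have "P = (dact (s \<otimes>\<^bsub>H\<^esub> b') W, dact (s \<otimes>\<^bsub>H\<^esub> b') V)"
        using sb(3) b' W(1) V(1) by (simp add: dact_mult)
      moreover have "s \<otimes>\<^bsub>H\<^esub> b' \<in> wball (Suc i)" using sb(1) b'(1) by auto
      ultimately have "P \<in> \<O> (Suc i)" unfolding \<O>_def by blast
      then show "P \<in> \<O> i" using i by simp
    qed
  qed
  have "i \<le> r" using i r by simp
  show ?thesis
  proof (intro allI ballI)
    fix m g assume "g \<in> wball m"
    then have "(dact g W, dact g V) \<in> \<O> i" using sub[of m] unfolding \<O>_def by blast
    then obtain b where "b \<in> wball i" "dact g W = dact b W" "dact g V = dact b V"
      unfolding \<O>_def by blast
    then show "\<exists>b\<in>wball r. dact g W = dact b W \<and> dact g V = dact b V"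
      using wball_le \<open>i \<le> r\<close> by blast
  qed
qed

text \<open>
  Up to a step that \<open>W\<close> hardly sees, every point of the orbit is a translate of \<open>x0\<close> by an element
  that fixes both \<open>W\<close> and \<open>V\<close>, hence also \<open>rho V W\<close>. So the whole orbit stays as close to \<open>rho V W\<close> as
  \<open>x0\<close> is.
\<close>

lemma tame_pair_bounded:
  assumes orb: "\<forall>m. \<forall>g\<in>wball m. \<exists>b\<in>wball r. dact g W = dact b W \<and> dact g V = dact b V"
    and W: "W \<in> S" "slow r W" and V: "V \<in> S" and VW: "V \<pitchfork> W"
    and base: "near (2 * E) W x0 (rho V W)"
  shows "\<not> oscillates Y W (6 * E)"
proof -
  obtain p where p: "p \<in> rho V W" using rho_transverse[OF V W(1) VW] by blast
  have rho: "rho V W \<subseteq> C W" using rho_transverse[OF V W(1) VW] by blast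
  have near: "dC W (proj W y) p \<le> 3 * E" if y: "y \<in> Y" for y
  proof -
    obtain m g where g: "g \<in> wball m" "y = act g x0" using orbit_words[OF y] by blast
    have gH: "g \<in> carrier H" using wball_in g by blast
    let ?g' = "inv\<^bsub>H\<^esub> g"
    obtain b where b: "b \<in> wball r" "dact ?g' W = dact b W" "dact ?g' V = dact b V"
      using orb wball_inv[OF g(1)] by blast
    have bH: "b \<in> carrier H" using wball_in b by blast
    let ?k = "g \<otimes>\<^bsub>H\<^esub> b" and ?x = "act (inv\<^bsub>H\<^esub> b) x0"
    have k: "?k \<in> carrier H" "dact ?k W = W" "dact ?k V = V"
      using gH bH W(1) V b dact_inv' by (simp_all add: dact_mult b(2,3)[symmetric])
    have x: "?x \<in> X" using bH act_in x0_in by simp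
    have "?k \<otimes>\<^bsub>H\<^esub> inv\<^bsub>H\<^esub> b = g" using gH bH by (simp add: grp.m_assoc)
    then have y': "act ?k ?x = y" using act_mult[OF k(1) _ x0_in, of "inv\<^bsub>H\<^esub> b"] bH g(2) by simp
    have step: "dpt W x0 ?x < E" using slowD[OF W(2,1) wball_inv[OF b(1)]] .
    have "near (3 * E) W ?x (rho V W)"
      unfolding near_def
    proof
      fix p assume p: "p \<in> rho V W"
      have "dC W (proj W ?x) p \<le> dC W (proj W x0) p + dpt W ?x x0"
        using W(1) x x0_in p rho by (intro dC_proj_shift) auto
      then show "dC W (proj W ?x) p \<le> 3 * E"
        using nearD[OF base p] step dpt_commute[OF W(1), of x0] by simp
    qed
    then have "near (3 * E) W y (rho V W)"
      using near_equivariant[OF k(1) W(1) V x, of "3 * E"] VW k(2,3) y' by simp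
    then show ?thesis using p nearD by blast
  qed
  have "dpt W x y \<le> 6 * E" if "x \<in> Y" "y \<in> Y" for x y
    using dpt_via[OF W(1), of x y p] near[OF that(1)] near[OF that(2)] that orbit_subset p rho by force
  then show ?thesis unfolding oscillates_def by force
qed

lemma finite_oscillation_bound:
  assumes "finite \<F>" "\<And>W. W \<in> \<F> \<Longrightarrow> \<exists>L. \<not> oscillates Y W L"
  shows "\<exists>L. \<forall>W\<in>\<F>. \<not> oscillates Y W L"
  using assms
proof (induction rule: finite_induct)
  case (insert W \<F>)
  obtain L L' where L: "\<forall>W\<in>\<F>. \<not> oscillates Y W L" "\<not> oscillates Y W L'"
    using insert by (meson insertI1 insertI2)
  have "\<forall>Z\<in>insert W \<F>. \<not> oscillates Y Z (max L L')"
    using L oscillates_mono by (metis insert_iff max.cobounded1 max.cobounded2)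
  then show ?case by blast
qed simp

text \<open>
  If no domain has unbounded orbit, let \<open>j\<close> be the greatest height at which the diameters are not
  uniformly bounded. By \<open>passing_up\<close>, a given pair of orbit points is seen by finitely many domains of
  height \<open>j\<close>; so the domains of height \<open>j\<close> in which some short word moves \<open>x0\<close> visibly have uniformly
  bounded diameter, and all those with larger diameter are slow. They have tame translates, of which
  two are transverse, and \<open>tame_pair_bounded\<close> applies to one of these two.
\<close>

lemma unbounded_nonempty:
  assumes "\<not> Metric_space.mbounded X dX Y"
  shows "unbounded \<noteq> {}"
proof
  assume empty: "unbounded = {}"
  then have bounded: "\<exists>L. \<not> oscillates Y W L" if "W \<in> S" for W
    using that unbounded_iff by blast
  have "\<exists>W\<in>S. oscillates Y W L" for L
  proof -
    obtain \<theta> where \<theta>: "\<forall>x\<in>X. \<forall>y\<in>X. dX x y > \<theta> \<longrightarrow> (\<exists>U\<in>S. dpt U x y > L)"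
      using uniqueness by blast
    have "\<not> (\<forall>x\<in>Y. \<forall>y\<in>Y. dX x y \<le> \<theta>)"
      using assms orbit_subset unfolding Metric_space.mbounded_alt[OF X_metric] by blast
    then obtain x y where "x \<in> Y" "y \<in> Y" "\<theta> < dX x y" by force
    then show ?thesis using \<theta> orbit_subset unfolding oscillates_def by blast
  qed
  then obtain j B where j: "\<And>L. \<exists>W\<in>S. height W = j \<and> oscillates Y W L"
    and B: "\<And>W. W \<in> S \<Longrightarrow> j < height W \<Longrightarrow> \<not> oscillates Y W B"
    using top_oscillating_height[of S] by blast
  obtain c where c: "\<And>\<W>. \<W> \<subseteq> S \<Longrightarrow> pairwise (\<bottom>) \<W> \<Longrightarrow> finite \<W> \<and> card \<W> \<le> c"
    using card_orthogonal_bounded by metis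
  define r where "r = 2 * Suc (c * c)"
  define seen where "seen b = {W \<in> S. height W = j \<and> E \<le> dpt W x0 (act b x0)}" for b
  have fin_seen: "finite (seen b)" if b: "b \<in> wball r" for b
  proof -
    have bH: "b \<in> carrier H" using wball_in b by blast
    have xy: "x0 \<in> Y" "act b x0 \<in> Y" using orbit_memI[OF grp.one_closed] act_one[OF x0_in] orbit_memI[OF bH] by auto
    have "visible_below B x0 (act b x0) (seen b)"
      unfolding visible_below_def
    proof (intro conjI ballI impI)
      fix D V assume D: "D \<in> seen b" "V \<in> S" "D \<sqsubset> V"
      then have "j < height V" using height_strict_mono[of D V] by (auto simp: seen_def)
      then show "dpt V x0 (act b x0) \<le> B" using B[OF D(2)] xy unfolding oscillates_def by force
    qed (auto simp: seen_def)
    then show ?thesis using passing_up[of B] xy orbit_subset by blast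
  qed
  have "finite (\<Union>b\<in>wball r. seen b)" using fin_seen grp.finite_word_ball[OF T(1)] by blast
  moreover have "(\<Union>b\<in>wball r. seen b) \<subseteq> S" by (auto simp: seen_def)
  ultimately obtain L1 where L1: "\<And>W. W \<in> (\<Union>b\<in>wball r. seen b) \<Longrightarrow> \<not> oscillates Y W L1"
    using finite_oscillation_bound bounded by (metis (no_types, lifting) subsetD)
  define L2 where "L2 = max L1 (2 * (11 * E))"
  have slow: "slow r W" if W: "W \<in> S" "height W = j" "oscillates Y W L2" for W
    unfolding slow_def
  proof (intro ballI)
    fix g b assume g: "g \<in> carrier H" and b: "b \<in> wball r"
    have "oscillates Y (dact g W) L1"
      using W g oscillates_mono by (auto simp: L2_def oscillates_equivariant)
    then have "dact g W \<notin> seen b" using L1 b by blast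
    then show "dpt (dact g W) x0 (act b x0) < E"
      using W g by (auto simp: seen_def height_equivariant dact_in)
  qed
  define \<Z> where "\<Z> = {W \<in> S. height W = j \<and> oscillates Y W L2 \<and> tame r W}"
  have \<Z>S: "\<Z> \<subseteq> S" by (auto simp: \<Z>_def)
  have wild: "\<exists>W\<in>\<Z>. oscillates Y W L" for L
  proof -
    obtain W where W: "W \<in> S" "height W = j" "oscillates Y W (max L L2)" using j by blast
    have osc: "oscillates Y W L" "oscillates Y W L2" "oscillates Y W (2 * (11 * E))"
      using oscillates_mono[OF W(3)] by (auto simp: L2_def)
    obtain g where g: "g \<in> carrier H" "tame r (dact g W)"
      using slow_tame_translate[OF W(1) slow[OF W(1,2) osc(2)] osc(3)] B W(2) by blast
    then have "dact g W \<in> \<Z>" "oscillates Y (dact g W) L"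
      using W osc by (auto simp: \<Z>_def dact_in height_equivariant oscillates_equivariant)
    then show ?thesis by blast
  qed
  have "\<not> pairwise (\<bottom>) \<Z>"
  proof
    assume "pairwise (\<bottom>) \<Z>"
    then have "finite \<Z>" using c \<Z>S by blast
    then obtain L where "\<forall>W\<in>\<Z>. \<not> oscillates Y W L"
      using finite_oscillation_bound[of \<Z>] bounded \<Z>S by blast
    then show False using wild by blast
  qed
  then obtain W V where WV: "W \<in> \<Z>" "V \<in> \<Z>" "V \<noteq> W" "\<not> V \<bottom> W" unfolding pairwise_def by blast
  then have W: "W \<in> S" "tame r W" "slow r W" and V: "V \<in> S" "tame r V" "slow r V"
    and osc: "oscillates Y W L2" "oscillates Y V L2" and h: "height V = height W"
    using slow by (auto simp: \<Z>_def)
  have VW: "V \<pitchfork> W" using transverse_if_same_height[OF V(1) W(1) h WV(3,4)] .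
  then have WV': "W \<pitchfork> V" using transverse_sym V(1) W(1) by blast
  note orb = tame_pair_orbit[OF c r_def W(1,2) V(1,2)] tame_pair_orbit[OF c r_def V(1,2) W(1,2)]
  have "6 * E \<le> L2" using E_nonneg by (simp add: L2_def)
  then have "oscillates Y W (6 * E)" "oscillates Y V (6 * E)" using osc oscillates_mono by blast+
  moreover have "near (2 * E) W x0 (rho V W) \<or> near (2 * E) V x0 (rho W V)"
    using transverse_near[OF V(1) W(1) VW x0_in] .
  ultimately show False
    using tame_pair_bounded[OF orb(1) W(1,3) V(1) VW] tame_pair_bounded[OF orb(2) V(1,3) W(1) WV'] by blast
qed

end

section \<open>The maximal unbounded domains\<close>

context pointed_hhs_action
begin

text \<open>
  Lifts of the generators to \<open>H\<close> generate the image of \<open>H\<close>, which is all that the orbit of \<open>x0\<close> depends on.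
\<close>

lemma unbounded_nonempty_if_finitely_generated:
  assumes "finitely_generated_in (BijGroup X) (act ` carrier H)"
    and "\<not> Metric_space.mbounded X dX Y"
  shows "unbounded \<noteq> {}"
proof -
  interpret act: group_hom H "BijGroup X" act by (rule on_space.group_hom)
  obtain A where A: "finite A" "A \<subseteq> act ` carrier H" "generate (BijGroup X) A = act ` carrier H"
    using assms(1) by (auto simp: finitely_generated_in_def)
  then obtain T0 where T0: "T0 \<subseteq> carrier H" "finite T0" "A = act ` T0"
    by (meson finite_subset_image)
  define T where "T = insert \<one>\<^bsub>H\<^esub> (T0 \<union> (\<lambda>s. inv\<^bsub>H\<^esub> s) ` T0)"
  have T: "finite T" "T \<subseteq> carrier H" "\<one>\<^bsub>H\<^esub> \<in> T" using T0 by (auto simp: T_def)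
  have T_inv: "inv\<^bsub>H\<^esub> s \<in> T" if "s \<in> T" for s
    using that T0(1) by (auto simp: T_def)
  have words: "\<exists>n. \<exists>g\<in>grp.word_ball T n. f = act g" if "f \<in> generate (BijGroup X) A" for f
    using that
  proof induction
    case one
    have "\<one>\<^bsub>BijGroup X\<^esub> = act \<one>\<^bsub>H\<^esub>" by simp
    then show ?case by (intro exI[of _ 0]) simp
  next
    case (incl f)
    then obtain s where "s \<in> T0" "f = act s" using T0 by blast
    then have "s \<in> grp.word_ball T 1" using grp.word_ball_generator[OF T(2), of s] by (auto simp: T_def)
    then show ?case using \<open>f = act s\<close> by blast
  next
    case (inv f)
    then obtain s where s: "s \<in> T0" "f = act s" using T0 by blast
    then have "inv\<^bsub>H\<^esub> s \<in> grp.word_ball T 1"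
      using grp.word_ball_generator[OF T(2), of "inv\<^bsub>H\<^esub> s"] by (auto simp: T_def)
    moreover have "inv\<^bsub>BijGroup X\<^esub> f = act (inv\<^bsub>H\<^esub> s)" using s T0(1) act.hom_inv by auto
    ultimately show ?case by blast
  next
    case (eng f f')
    then obtain m n g g' where g: "g \<in> grp.word_ball T m" "f = act g"
      and g': "g' \<in> grp.word_ball T n" "f' = act g'" by blast
    have "g \<in> carrier H" "g' \<in> carrier H" using g g' grp.word_ball_subset[OF T(2)] by blast+
    then have "f \<otimes>\<^bsub>BijGroup X\<^esub> f' = act (g \<otimes>\<^bsub>H\<^esub> g')" using g g' act.hom_mult by simp
    then show ?case using grp.word_ball_mult[OF T(2) g(1) g'(1)] by blast
  qed
  have orbit: "\<exists>n. \<exists>g\<in>grp.word_ball T n. y = act g x0" if y: "y \<in> Y" for y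
  proof -
    obtain h where h: "h \<in> carrier H" "y = act h x0" using y by (auto simp: orbit_def)
    then have "act h \<in> generate (BijGroup X) A" using A(3) by blast
    then obtain n g where "g \<in> grp.word_ball T n" "act h = act g" using words by blast
    then show ?thesis using h(2) by auto
  qed
  interpret gen: generated_hhs_action H X dX S E C dC proj nest orth rho rhomap act dact iso x0 T
    using T T_inv orbit by unfold_locales auto
  show ?thesis using gen.unbounded_nonempty assms(2) by blast
qed

definition maximal_unbounded where
  "maximal_unbounded = {W \<in> unbounded. \<forall>V\<in>unbounded. \<not> W \<sqsubset> V}"

lemma nested_in_maximal_unbounded: "U \<in> unbounded \<Longrightarrow> \<exists>W\<in>maximal_unbounded. U \<sqsubseteq> W"
  using exists_maximal_above[OF unbounded_in_S, of U] by (force simp: maximal_unbounded_def pnest_def)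

lemma maximal_unbounded_orthogonal: "pairwise (\<bottom>) maximal_unbounded"
proof (rule pairwiseI)
  fix U V assume UV: "U \<in> maximal_unbounded" "V \<in> maximal_unbounded" "U \<noteq> V"
  then have "\<not> U \<pitchfork> V"
    by (intro maximal_unbounded_not_transverse) (auto simp: maximal_unbounded_def)
  moreover have "\<not> U \<sqsubseteq> V" "\<not> V \<sqsubseteq> U"
    using UV by (auto simp: maximal_unbounded_def pnest_def)
  ultimately show "U \<bottom> V" using UV(3) by (auto simp: transverse_def)
qed

lemma finite_maximal_unbounded: "finite maximal_unbounded"
proof -
  have "maximal_unbounded \<subseteq> S" using unbounded_in_S by (auto simp: maximal_unbounded_def)
  then show ?thesis using card_orthogonal_bounded maximal_unbounded_orthogonal by blast
qed

lemma translate_maximal_unbounded: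
  assumes g: "g \<in> carrier H" and W: "W \<in> maximal_unbounded"
  shows "dact g W \<in> maximal_unbounded"
proof -
  have WS: "W \<in> S" and Wu: "W \<in> unbounded" using W unbounded_in_S by (auto simp: maximal_unbounded_def)
  have "\<not> dact g W \<sqsubset> V" if V: "V \<in> unbounded" for V
  proof
    assume gW: "dact g W \<sqsubset> V"
    have VS: "V \<in> S" using V unbounded_in_S by blast
    let ?g' = "inv\<^bsub>H\<^esub> g"
    have g': "?g' \<in> carrier H" using g by simp
    have "W \<sqsubset> dact ?g' V"
      using dact_pnest[OF g' dact_in[OF g WS] VS] gW dact_inv[OF g WS] by simp
    moreover have "dact ?g' V \<in> unbounded" using unbounded_equivariant[OF g' VS] V by blast
    ultimately show False using W by (auto simp: maximal_unbounded_def)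
  qed
  then show ?thesis using unbounded_equivariant[OF g WS] Wu by (auto simp: maximal_unbounded_def)
qed

lemma maximal_unbounded_invariant:
  assumes g: "g \<in> carrier H"
  shows "dact g ` maximal_unbounded = maximal_unbounded"
proof
  show "dact g ` maximal_unbounded \<subseteq> maximal_unbounded"
    using translate_maximal_unbounded[OF g] by blast
  show "maximal_unbounded \<subseteq> dact g ` maximal_unbounded"
  proof
    fix W assume W: "W \<in> maximal_unbounded"
    then have "dact (inv\<^bsub>H\<^esub> g) W \<in> maximal_unbounded" using translate_maximal_unbounded g by simp
    moreover have "W \<in> S" using W unbounded_in_S by (auto simp: maximal_unbounded_def)
    ultimately show "W \<in> dact g ` maximal_unbounded" using dact_inv'[OF g] by (metis imageI)
  qed
qed

end

theorem theorem5p1: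
  fixes H :: "('h, 'm) monoid_scheme"
    and X :: "'x set" and dX :: "'x \<Rightarrow> 'x \<Rightarrow> real"
    and S :: "'u set" and E :: real
    and C :: "'u \<Rightarrow> 'c set" and dC :: "'u \<Rightarrow> 'c \<Rightarrow> 'c \<Rightarrow> real"
    and proj :: "'u \<Rightarrow> 'x \<Rightarrow> 'c"
    and nest orth :: "'u \<Rightarrow> 'u \<Rightarrow> bool"
    and rho :: "'u \<Rightarrow> 'u \<Rightarrow> 'c set" and rhomap :: "'u \<Rightarrow> 'u \<Rightarrow> 'c \<Rightarrow> 'c set"
    and act :: "'h \<Rightarrow> 'x \<Rightarrow> 'x" and dact :: "'h \<Rightarrow> 'u \<Rightarrow> 'u"
    and iso :: "'h \<Rightarrow> 'u \<Rightarrow> 'c \<Rightarrow> 'c"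
    and x0 :: 'x
  assumes "hhs_automorphism_action H X dX S E C dC proj nest orth rho rhomap act dact iso"
    and "x0 \<in> X"
  shows "\<exists>\<E>. finite \<E> \<and> \<E> \<subseteq> unbounded_domains H S C dC proj act x0 \<and>
           (\<forall>g\<in>carrier H. dact g ` \<E> = \<E>) \<and>
           pairwise orth \<E> \<and>
           (\<forall>U\<in>unbounded_domains H S C dC proj act x0. \<exists>W\<in>\<E>. nest U W) \<and>
           (\<E> \<noteq> {} \<longleftrightarrow> unbounded_domains H S C dC proj act x0 \<noteq> {}) \<and>
           (finitely_generated_in (BijGroup X) (act ` carrier H) \<and>
            \<not> Metric_space.mbounded X dX (orbit H act x0) \<longrightarrow>
            unbounded_domains H S C dC proj act x0 \<noteq> {} \<and> \<E> \<noteq> {})"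
proof -
  interpret pointed_hhs_action H X dX S E C dC proj nest orth rho rhomap act dact iso x0
    using assms by (simp add: pointed_hhs_action_def pointed_hhs_action_axioms_def)
  have sub: "maximal_unbounded \<subseteq> unbounded" by (auto simp: maximal_unbounded_def)
  then have ne: "maximal_unbounded \<noteq> {} \<longleftrightarrow> unbounded \<noteq> {}"
    using nested_in_maximal_unbounded by blast
  show ?thesis
    using finite_maximal_unbounded sub maximal_unbounded_invariant maximal_unbounded_orthogonal
      nested_in_maximal_unbounded ne unbounded_nonempty_if_finitely_generated
    by (intro exI[of _ maximal_unbounded]) blast
qed

end
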